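(* Let $n\geqslant 5$. There exists no local analytic hypersurface $H^n\subset\mathbb{R}^{n+1}$ which is affinely homogeneous, has constant Hessian rank $1$, and is nondegenerate.
   Context: All hypersurfaces are local and real analytic, with a base point $p_0$. Constant Hessian rank $1$: in affine coordinates in which $H$ is a graph $u=F(x_1,\dots,x_n)$, the matrix $\big(F_{x_ix_j}(x)\big)_{1\leqslant i,j\leqslant n}$ has rank $1$ for all $x$ near the base point (an affinely invariant condition). Affinely homogeneous: an affine vector field on $\mathbb{R}^{n+1}$ is one whose coefficients are polynomials of degree $\leqslant 1$ in the coordinates. Let $\mathfrak{sym}(H)$ be the Lie algebra of affine vector fields $L$ with $L|_H$ tangent to $H$. Then $H$ is (locally) affinely homogeneous if $T_{p_0}H=\mathrm{Span}_{\mathbb{R}}\{L|_{p_0}:L\in\mathfrak{sym}(H)\}$. Nondegenerate: in suitable affine coordinates $(x_1,\dots,x_n,u)$ centered at $p_0$, obtained by an invertible affine transformation, $H$ is graphed as $$u=\frac{x_1^2}{2}+\frac{x_1^2x_2}{2}+\sum_{m=3}^n\Big(\frac{x_1^mx_m}{m!}+x_1^{m-1}\sum_{\substack{2\leqslant i,j\leqslant n\\ i+j=m+1}}\frac12\frac{x_ix_j}{(i-1)!(j-1)!}\Big)+O_{x_2,\dots,x_n}(3)+O_{x_1,\dots,x_n}(n+2),$$ where $O_{x_1,\dots,x_n}(\kappa)$ denotes a convergent power series with all monomials of total degree $\geqslant\kappa$, and $O_{x_2,\dots,x_n}(\kappa)$ a convergent power series in $(x_1,\dots,x_n)$ with all monomials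 of degree $\geqslant\kappa$ in $(x_2,\dots,x_n)$. *)

theory Defs
  imports "HOL-Analysis.Analysis"
begin

text \<open>
  The space \<open>\<real>\<^sup>n\<^sup>+\<^sup>1\<close> is \<open>(real^'n) \<times> real\<close> with \<open>n = CARD('n)\<close>.
  A local hypersurface is a set \<open>H\<close> with a base point \<open>p0\<close>; every notion below depends only on
  the germ of \<open>H\<close> at \<open>p0\<close>.
\<close>

subsection \<open>Convergent power series in several real variables\<close>

definition monomial_fun :: "('n::finite \<Rightarrow> nat) \<Rightarrow> real^'n \<Rightarrow> real" where
  "monomial_fun \<alpha> x = (\<Prod>i\<in>UNIV. (x $ i) ^ \<alpha> i)"

text \<open>The sum over all multi-indices \<open>\<alpha>\<close> is unordered, that is, absolutely convergent.\<close>

definition has_power_series_at ::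
    "(real^'n::finite \<Rightarrow> real) \<Rightarrow> (('n \<Rightarrow> nat) \<Rightarrow> real) \<Rightarrow> real^'n \<Rightarrow> bool" where
  "has_power_series_at f c a \<longleftrightarrow>
     (\<exists>r>0. \<forall>x\<in>ball a r. ((\<lambda>\<alpha>. c \<alpha> * monomial_fun \<alpha> (x - a)) has_sum f x) UNIV)"

definition real_analytic_at :: "(real^'n::finite \<Rightarrow> real) \<Rightarrow> real^'n \<Rightarrow> bool" where
  "real_analytic_at f a \<longleftrightarrow> (\<exists>c. has_power_series_at f c a)"

text \<open>
  \<open>f \<in> big_O_vars J \<kappa>\<close>: near \<open>0\<close>, \<open>f\<close> is a convergent power series in all the variables, each of
  whose monomials has degree at least \<open>\<kappa>\<close> in the variables indexed by \<open>J\<close>.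
\<close>

definition big_O_vars :: "'n set \<Rightarrow> nat \<Rightarrow> (real^'n::finite \<Rightarrow> real) set" where
  "big_O_vars J \<kappa> =
     {f. \<exists>c. has_power_series_at f c 0 \<and> (\<forall>\<alpha>. c \<alpha> \<noteq> 0 \<longrightarrow> \<kappa> \<le> (\<Sum>i\<in>J. \<alpha> i))}"

subsection \<open>Affine coordinates and analytic hypersurfaces\<close>

definition affine_iso :: "('a::real_vector \<Rightarrow> 'b::real_vector) \<Rightarrow> bool" where
  "affine_iso \<phi> \<longleftrightarrow> (\<exists>M c. linear M \<and> bij M \<and> \<phi> = (\<lambda>p. M p + c))"

text \<open>
  In the affine coordinates \<open>(x, u) = \<phi> p\<close>, the set \<open>H\<close> is near \<open>p0\<close> the graph \<open>u = F x\<close> of an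
  analytic function; only the germ of \<open>F\<close> at the \<open>x\<close>-coordinate of \<open>p0\<close> matters.
\<close>

definition is_graph_at ::
    "((real^'n::finite) \<times> real \<Rightarrow> (real^'n) \<times> real) \<Rightarrow> (real^'n \<Rightarrow> real) \<Rightarrow>
     ((real^'n) \<times> real) set \<Rightarrow> (real^'n) \<times> real \<Rightarrow> bool" where
  "is_graph_at \<phi> F H p0 \<longleftrightarrow>
     affine_iso \<phi> \<and> p0 \<in> H \<and> real_analytic_at F (fst (\<phi> p0)) \<and>
     (\<exists>U. open U \<and> p0 \<in> U \<and> (\<forall>p\<in>U. p \<in> H \<longleftrightarrow> snd (\<phi> p) = F (fst (\<phi> p))))"

definition local_analytic_hypersurface ::
    "((real^'n::finite) \<times> real) set \<Rightarrow> (real^'n) \<times> real \<Rightarrow> bool" where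
  "local_analytic_hypersurface H p0 \<longleftrightarrow> (\<exists>\<phi> F. is_graph_at \<phi> F H p0)"

subsection \<open>Constant Hessian rank one\<close>

definition partial_deriv :: "'n \<Rightarrow> (real^'n::finite \<Rightarrow> real) \<Rightarrow> real^'n \<Rightarrow> real" where
  "partial_deriv i F x = deriv (\<lambda>t. F (x + t *\<^sub>R axis i 1)) 0"

definition hessian :: "(real^'n::finite \<Rightarrow> real) \<Rightarrow> real^'n \<Rightarrow> real^'n^'n" where
  "hessian F x = (\<chi> i j. partial_deriv j (partial_deriv i F) x)"

text \<open>
  The condition is affinely invariant, so it is only required in some affine coordinates in which
  \<open>H\<close> is a graph.
\<close>

definition constant_hessian_rank_one ::
    "((real^'n::finite) \<times> real) set \<Rightarrow> (real^'n) \<times> real \<Rightarrow> bool" where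
  "constant_hessian_rank_one H p0 \<longleftrightarrow>
     (\<exists>\<phi> F. is_graph_at \<phi> F H p0 \<and> (\<forall>\<^sub>F x in nhds (fst (\<phi> p0)). rank (hessian F x) = 1))"

subsection \<open>Affine homogeneity\<close>

text \<open>Velocities at \<open>q\<close> of curves in \<open>H\<close>.\<close>

definition tangent_space :: "'a::real_normed_vector set \<Rightarrow> 'a \<Rightarrow> 'a set" where
  "tangent_space H q =
     {v. \<exists>\<gamma>. \<gamma> 0 = q \<and> (\<forall>\<^sub>F t in nhds 0. \<gamma> t \<in> H) \<and> (\<gamma> has_vector_derivative v) (at 0)}"

definition affine_vector_field :: "('a::real_vector \<Rightarrow> 'a) \<Rightarrow> bool" where
  "affine_vector_field L \<longleftrightarrow> (\<exists>A b. linear A \<and> L = (\<lambda>p. A p + b))"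

definition affine_sym :: "'a::real_normed_vector set \<Rightarrow> 'a \<Rightarrow> ('a \<Rightarrow> 'a) set" where
  "affine_sym H p0 =
     {L. affine_vector_field L \<and>
         (\<exists>U. open U \<and> p0 \<in> U \<and> (\<forall>q\<in>H \<inter> U. L q \<in> tangent_space H q))}"

definition affinely_homogeneous :: "'a::real_normed_vector set \<Rightarrow> 'a \<Rightarrow> bool" where
  "affinely_homogeneous H p0 \<longleftrightarrow> tangent_space H p0 = span {L p0 |L. L \<in> affine_sym H p0}"

subsection \<open>Nondegeneracy\<close>

text \<open>
  The map \<open>e\<close> numbers the coordinates: \<open>x\<^sub>k\<close> is \<open>x $ e k\<close> for \<open>1 \<le> k \<le> n\<close>.
\<close>

definition normal_form_part :: "(nat \<Rightarrow> 'n) \<Rightarrow> real^'n::finite \<Rightarrow> real" where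
  "normal_form_part e x =
     (x $ e 1)^2 / 2 + (x $ e 1)^2 * (x $ e 2) / 2
     + (\<Sum>m = 3..CARD('n).
          (x $ e 1)^m * (x $ e m) / fact m
          + (x $ e 1)^(m - 1) *
            (\<Sum>(i, j) \<in> {(i, j). 2 \<le> i \<and> i \<le> CARD('n) \<and> 2 \<le> j \<and> j \<le> CARD('n) \<and> i + j = m + 1}.
               1/2 * ((x $ e i) * (x $ e j) / (fact (i - 1) * fact (j - 1)))))"

text \<open>
  Quantifying over the numbering \<open>e\<close> is harmless: a permutation of the coordinates is an
  invertible affine transformation, so any fixed numbering gives the same notion.
\<close>

definition nondegenerate ::
    "((real^'n::finite) \<times> real) set \<Rightarrow> (real^'n) \<times> real \<Rightarrow> bool" where
  "nondegenerate H p0 \<longleftrightarrow>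
     (\<exists>e \<phi> F R S.
        bij_betw e {1..CARD('n)} (UNIV :: 'n set) \<and>
        \<phi> p0 = 0 \<and> is_graph_at \<phi> F H p0 \<and>
        R \<in> big_O_vars (e ` {2..CARD('n)}) 3 \<and>
        S \<in> big_O_vars UNIV (CARD('n) + 2) \<and>
        (\<forall>\<^sub>F x in nhds 0. F x = normal_form_part e x + R x + S x))"

end

theory Submission
  imports Defs
begin

text \<open>
  Let \<open>u = F(x)\<close> be the hypersurface in the coordinates of the normal form. Its conormal
  \<open>(1, -F\<^sub>x\<^sub>1, \<dots>, -F\<^sub>x\<^sub>n)\<close> depends on one parameter only, because the Hessian has rank one.
  Restricting it to the \<open>x\<^sub>1\<close>-axis, one gets (up to signs) the curve
  \<open>\<gamma> = (1, F\<^sub>x\<^sub>1, \<dots>, F\<^sub>x\<^sub>n)\<close> in \<open>\<real>\<^sup>n\<^sup>+\<^sup>1\<close>, and by the normal form its components are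
  \<open>\<gamma>\<^sub>j = x\<^sup>j/j! + O(x\<^sup>n\<^sup>+\<^sup>1)\<close> for \<open>0 \<le> j \<le> n\<close>; so \<open>\<gamma>\<close> and its first \<open>n\<close> derivatives are linearly
  independent at \<open>0\<close> (lemma \<open>nondegenerate_gradient_on_axis\<close>).

  An affine vector field \<open>p \<mapsto> A p + b\<close> tangent to the hypersurface moves the tangent hyperplanes
  among themselves. Infinitesimally, a matrix \<open>P\<close> made of the entries of \<open>A\<close> satisfies
  \<open>P \<gamma> = \<lambda> \<gamma> + \<mu> \<gamma>'\<close> for two scalar power series \<open>\<lambda>\<close>, \<open>\<mu>\<close>
  (lemma \<open>tangent_affine_field_moves_conormal_curve\<close>). This is the equation for infinitesimal projective
  symmetries of the curve \<open>\<gamma>\<close>, and a curve that spans its space has at most as many of them as the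
  rational normal curve: \<open>P\<close> is zero as soon as the four numbers \<open>\<lambda>(0)\<close>, \<open>\<mu>(0)\<close>, \<open>\<mu>'(0)\<close>,
  \<open>\<mu>''(0)\<close> are zero (lemma \<open>osculating_curve_symmetry_trivial\<close>). A tangent field with \<open>A = 0\<close> is
  a constant vector annihilated by all conormals, hence zero as well. So the affine symmetry algebra has
  dimension at most \<open>4\<close>, whereas homogeneity needs fields with \<open>n\<close> independent values at the base
  point. This is impossible for \<open>n \<ge> 5\<close> (lemma \<open>no_transitive_affine_symmetry\<close>).

  Two things have to be supplied before this argument applies. Convergent power series in several
  variables are differentiated term by term; and the rank condition, which is only assumed in some graph
  coordinates, is carried over to those of the normal form.
\<close>

section \<open>Termwise differentiation of power series in several variables\<close>

lemma has_derivative_imp_line_derivative: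
  assumes "(f has_derivative f') (at x)"
  shows "((\<lambda>t. f (x + t *\<^sub>R v)) has_field_derivative f' v) (at 0)"
proof -
  have "((\<lambda>t. x + t *\<^sub>R v) has_derivative (\<lambda>t. t *\<^sub>R v)) (at (0::real))"
    by (auto intro!: derivative_eq_intros)
  from diff_chain_at[OF this, of f f'] assms
  have "((\<lambda>t. f (x + t *\<^sub>R v)) has_derivative (\<lambda>t. f' (t *\<^sub>R v))) (at 0)"
    by (simp add: o_def)
  moreover have "(\<lambda>t. f' (t *\<^sub>R v)) = (\<lambda>t. t * f' v)"
    using has_derivative_bounded_linear[OF assms] by (auto simp: linear_simps)
  ultimately show ?thesis
    by (simp add: has_field_derivative_def mult_commute_abs)
qed

lemma partial_deriv_eq_derivative_axis:
  assumes "(f has_derivative f') (at x)"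
  shows "partial_deriv i f x = f' (axis i 1)"
  unfolding partial_deriv_def by (rule DERIV_imp_deriv[OF has_derivative_imp_line_derivative[OF assms]])

lemma monomial_fun_has_derivative:
  "(monomial_fun \<alpha> has_derivative
     (\<lambda>h. \<Sum>i\<in>UNIV. h $ i * (real (\<alpha> i) * monomial_fun (\<alpha>(i := \<alpha> i - 1)) x))) (at x)"
proof -
  have nth: "((\<lambda>x. x $ i) has_derivative (\<lambda>h. h $ i)) (at x)" for i
    by (rule bounded_linear_imp_has_derivative[OF bounded_linear_vec_nth])
  have "(monomial_fun \<alpha> has_derivative (\<lambda>h. \<Sum>i\<in>UNIV.
      (of_nat (\<alpha> i) * h $ i * (x $ i) ^ (\<alpha> i - 1)) * (\<Prod>j\<in>UNIV - {i}. (x $ j) ^ \<alpha> j))) (at x)"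
    unfolding monomial_fun_def[abs_def]
    by (rule has_derivative_prod) (rule has_derivative_power[OF nth])
  moreover have "(x $ i) ^ (\<alpha> i - 1) * (\<Prod>j\<in>UNIV - {i}. (x $ j) ^ \<alpha> j)
      = monomial_fun (\<alpha>(i := \<alpha> i - 1)) x" for i
    unfolding monomial_fun_def by (subst prod.remove[of _ i]) auto
  ultimately show ?thesis
    by (simp add: mult_ac)
qed

lemma abs_monomial_fun_le:
  assumes "\<And>i. \<bar>x $ i\<bar> \<le> s"
  shows "\<bar>monomial_fun \<alpha> x\<bar> \<le> s ^ (\<Sum>i\<in>UNIV. \<alpha> i)"
proof -
  have "\<bar>monomial_fun \<alpha> x\<bar> = (\<Prod>i\<in>UNIV. \<bar>x $ i\<bar> ^ \<alpha> i)"
    by (simp add: monomial_fun_def abs_prod power_abs)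
  also have "\<dots> \<le> (\<Prod>i\<in>UNIV. s ^ \<alpha> i)"
    by (intro prod_mono) (auto intro: power_mono assms)
  finally show ?thesis
    by (simp add: power_sum)
qed

text \<open>
  Halving the radius absorbs the factor \<open>k\<close> that differentiation brings in; this is the majorant for the
  differentiated series.
\<close>

lemma nat_times_half_power_le:
  fixes s :: real
  assumes "s > 0"
  shows "real k * (s / 2) ^ (k - 1) \<le> 2 / s * s ^ k"
proof (cases k)
  case (Suc m)
  have "Suc m \<le> 2 ^ Suc m"
    by (meson less_exp less_imp_le)
  then have "real (Suc m) \<le> 2 * 2 ^ m"
    by (metis of_nat_le_iff of_nat_numeral of_nat_power power_Suc)
  then have "real (Suc m) * (s ^ m / 2 ^ m) \<le> (2 * 2 ^ m) * (s ^ m / 2 ^ m)"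
    using assms by (intro mult_right_mono) auto
  then show ?thesis
    using assms by (simp add: Suc power_divide)
qed (use assms in simp)

text \<open>
  Absolute convergence at the point \<open>a + (s, \<dots>, s)\<close> bounds every coefficient, and gives a summable
  majorant of the differentiated series on the ball of radius \<open>s/2\<close>. After an enumeration of the
  multi-indices, the Weierstrass test and termwise differentiation of sequences of functions apply.
\<close>

lemma has_power_series_at_derivative_aux:
  fixes f :: "real^'n::finite \<Rightarrow> real"
  assumes "has_power_series_at f c a"
  obtains r D where "r > 0"
    "\<And>x. x \<in> ball a r \<Longrightarrow> (f has_derivative (\<lambda>h. \<Sum>i\<in>UNIV. h $ i * D i x)) (at x)"
    "\<And>x i. x \<in> ball a r \<Longrightarrow>
       ((\<lambda>\<beta>. real (\<beta> i + 1) * c (\<beta>(i := \<beta> i + 1)) * monomial_fun \<beta> (x - a)) has_sum D i x) UNIV"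
proof -
  obtain r0 where r0: "r0 > 0"
    and sum0: "\<And>x. x \<in> ball a r0 \<Longrightarrow> ((\<lambda>\<alpha>. c \<alpha> * monomial_fun \<alpha> (x - a)) has_sum f x) UNIV"
    using assms unfolding has_power_series_at_def by blast
  define s where "s = r0 / (2 * CARD('n))"
  have s: "s > 0"
    using r0 by (simp add: s_def)
  define deg where "deg = (\<lambda>\<alpha>::'n \<Rightarrow> nat. \<Sum>i\<in>UNIV. \<alpha> i)"
  define B where "B = (\<lambda>\<alpha>. 2 / s * (\<bar>c \<alpha>\<bar> * s ^ deg \<alpha>))"
  have B_summable: "B summable_on UNIV"
  proof -
    \<comment> \<open>\<open>s\<close> is so small that the corner of the cube of side \<open>s\<close> is still in the ball of convergence.\<close>
    have "norm (\<chi> i::'n. s) \<le> (\<Sum>i\<in>(UNIV::'n set). \<bar>(\<chi> i::'n. s) $ i\<bar>)"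
      by (rule norm_le_l1_cart)
    also have "\<dots> < r0"
      using s r0 by (simp add: s_def)
    finally have "a + (\<chi> i. s) \<in> ball a r0"
      by (simp add: dist_norm)
    from sum0[OF this] have "(\<lambda>\<alpha>. c \<alpha> * s ^ deg \<alpha>) summable_on UNIV"
      by (auto dest!: has_sum_imp_summable simp: monomial_fun_def power_sum deg_def)
    then have "(\<lambda>\<alpha>. norm (c \<alpha> * s ^ deg \<alpha>)) summable_on UNIV"
      by (rule summable_on_iff_abs_summable_on_real[THEN iffD1])
    then have "(\<lambda>\<alpha>. \<bar>c \<alpha>\<bar> * s ^ deg \<alpha>) summable_on UNIV"
      using s by (simp add: abs_mult)
    then show ?thesis
      unfolding B_def by (rule summable_on_cmult_right)
  qed
  define T where "T = (\<lambda>i \<alpha> x. c \<alpha> * (real (\<alpha> i) * monomial_fun (\<alpha>(i := \<alpha> i - 1)) (x - a)))"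
  define r where "r = min r0 (s / 2)"
  have r: "r > 0" "r \<le> r0" "r \<le> s / 2"
    using r0 s by (auto simp: r_def)
  have T_le: "\<bar>T i \<alpha> x\<bar> \<le> B \<alpha>" if "x \<in> ball a r" for i \<alpha> x
  proof (cases "\<alpha> i = 0")
    case True
    then show ?thesis
      using s by (simp add: T_def B_def)
  next
    case False
    have "\<bar>(x - a) $ j\<bar> \<le> s / 2" for j
      using component_le_norm_cart[of "x - a" j] that r by (simp add: dist_norm norm_minus_commute)
    then have "\<bar>monomial_fun (\<alpha>(i := \<alpha> i - 1)) (x - a)\<bar> \<le> (s / 2) ^ deg (\<alpha>(i := \<alpha> i - 1))"
      unfolding deg_def by (rule abs_monomial_fun_le)
    also have "deg (\<alpha>(i := \<alpha> i - 1)) = deg \<alpha> - 1"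
      using False unfolding deg_def by (subst (1 2) sum.remove[of _ i]) auto
    finally have "real (\<alpha> i) * \<bar>monomial_fun (\<alpha>(i := \<alpha> i - 1)) (x - a)\<bar>
        \<le> real (deg \<alpha>) * (s / 2) ^ (deg \<alpha> - 1)"
      using member_le_sum[of i UNIV \<alpha>] s by (intro mult_mono) (auto simp: deg_def simp del: of_nat_sum fun_upd_apply)
    also have "\<dots> \<le> 2 / s * s ^ deg \<alpha>"
      by (rule nat_times_half_power_le[OF s])
    finally have "\<bar>c \<alpha>\<bar> * (real (\<alpha> i) * \<bar>monomial_fun (\<alpha>(i := \<alpha> i - 1)) (x - a)\<bar>)
        \<le> \<bar>c \<alpha>\<bar> * (2 / s * s ^ deg \<alpha>)"
      by (intro mult_left_mono) auto
    then show ?thesis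
      by (simp add: T_def B_def abs_mult mult_ac)
  qed
  define D where "D = (\<lambda>i x. infsum (\<lambda>\<alpha>. T i \<alpha> x) UNIV)"
  have D: "((\<lambda>\<alpha>. T i \<alpha> x) has_sum D i x) UNIV" if "x \<in> ball a r" for i x
  proof -
    have "norm (T i \<alpha> x) \<le> norm (B \<alpha>)" for \<alpha>
      using order_trans[OF T_le[OF that] abs_ge_self] by simp
    then have "(\<lambda>\<alpha>. norm (T i \<alpha> x)) summable_on UNIV"
      by (rule Infinite_Sum.abs_summable_on_comparison_test[OF B_summable[THEN summable_on_iff_abs_summable_on_real[THEN iffD1]]])
    from Infinite_Sum.abs_summable_summable[OF this] show ?thesis
      unfolding D_def by (rule has_sum_infsum)
  qed
  have D_series: "((\<lambda>\<beta>. real (\<beta> i + 1) * c (\<beta>(i := \<beta> i + 1)) * monomial_fun \<beta> (x - a)) has_sum D i x) UNIV"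
    if "x \<in> ball a r" for i x
  proof -
    \<comment> \<open>Only monomials containing the \<open>i\<close>-th variable survive; shifting that exponent by one enumerates them.\<close>
    have "((\<lambda>\<alpha>. T i \<alpha> x) has_sum D i x) {\<alpha>. \<alpha> i \<noteq> 0}"
      using D[OF that, of i] by (subst has_sum_cong_neutral[where T = UNIV]) (auto simp: T_def)
    moreover have "bij_betw (\<lambda>\<beta> :: 'n \<Rightarrow> nat. \<beta>(i := \<beta> i + 1)) UNIV {\<alpha>. \<alpha> i \<noteq> 0}"
      by (rule bij_betw_byWitness[where f' = "\<lambda>\<alpha> :: 'n \<Rightarrow> nat. \<alpha>(i := \<alpha> i - 1)"]) (auto simp: fun_upd_idem)
    ultimately have "((\<lambda>\<beta>. T i (\<beta>(i := \<beta> i + 1)) x) has_sum D i x) UNIV"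
      by (subst has_sum_reindex_bij_betw[of "\<lambda>\<beta>. \<beta>(i := \<beta> i + 1)" UNIV "{\<alpha>. \<alpha> i \<noteq> 0}" "\<lambda>\<alpha>. T i \<alpha> x"])
    then show ?thesis
      by (simp add: T_def mult_ac)
  qed
  have "infinite (UNIV :: ('n \<Rightarrow> nat) set)"
    by (metis finite_fun_UNIVD2 infinite_UNIV_nat)
  then obtain \<sigma> :: "nat \<Rightarrow> 'n \<Rightarrow> nat" where \<sigma>: "bij \<sigma>"
    using bij_betw_from_nat_into[of "UNIV :: ('n \<Rightarrow> nat) set"] by auto
  have unif: "uniform_limit (ball a r) (\<lambda>N x. \<Sum>k<N. T i (\<sigma> k) x) (D i) sequentially" for i
  proof -
    have "summable (\<lambda>k. B (\<sigma> k))"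
      using has_sum_infsum[OF B_summable] has_sum_reindex_bij_betw[OF \<sigma>, of B]
      by (meson has_sum_imp_sums sums_summable)
    then have "uniform_limit (ball a r) (\<lambda>N x. \<Sum>k<N. T i (\<sigma> k) x) (\<lambda>x. \<Sum>k. T i (\<sigma> k) x) sequentially"
      by (intro Weierstrass_m_test) (use T_le in auto)
    moreover have "(\<Sum>k. T i (\<sigma> k) x) = D i x" if "x \<in> ball a r" for x
      using D[OF that, of i] has_sum_reindex_bij_betw[OF \<sigma>, of "\<lambda>\<alpha>. T i \<alpha> x"]
      by (metis has_sum_imp_sums sums_unique)
    ultimately show ?thesis
      by (subst uniform_limit_cong'[where g = "\<lambda>N x. \<Sum>k<N. T i (\<sigma> k) x" and i = "\<lambda>x. \<Sum>k. T i (\<sigma> k) x"]) auto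
  qed
  have sums_f: "(\<lambda>k. c (\<sigma> k) * monomial_fun (\<sigma> k) (x - a)) sums f x" if "x \<in> ball a r" for x
    using sum0[of x] that r has_sum_reindex_bij_betw[OF \<sigma>, of "\<lambda>\<alpha>. c \<alpha> * monomial_fun \<alpha> (x - a)"]
    by (auto intro!: has_sum_imp_sums)
  have "\<exists>g. \<forall>x\<in>ball a r. (\<lambda>k. c (\<sigma> k) * monomial_fun (\<sigma> k) (x - a)) sums g x \<and>
      (g has_derivative (\<lambda>h. \<Sum>i\<in>UNIV. h $ i * D i x)) (at x within ball a r)"
  proof (rule has_derivative_series)
    show "((\<lambda>x. c (\<sigma> k) * monomial_fun (\<sigma> k) (x - a)) has_derivative
        (\<lambda>h. \<Sum>i\<in>UNIV. h $ i * T i (\<sigma> k) x)) (at x within ball a r)" for k x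
    proof -
      have "((\<lambda>x. x - a) has_derivative (\<lambda>h. h)) (at x)"
        by (auto intro!: derivative_eq_intros)
      from diff_chain_at[OF this, OF monomial_fun_has_derivative]
      have "((\<lambda>x. monomial_fun (\<sigma> k) (x - a)) has_derivative (\<lambda>h. \<Sum>i\<in>UNIV. h $ i *
          (real (\<sigma> k i) * monomial_fun ((\<sigma> k)(i := \<sigma> k i - 1)) (x - a)))) (at x)"
        by (simp add: o_def)
      from has_derivative_mult_right[OF this, of "c (\<sigma> k)"] show ?thesis
        by (auto simp: T_def sum_distrib_left mult_ac intro: has_derivative_at_withinI)
    qed
    show "\<forall>\<^sub>F N in sequentially. \<forall>x\<in>ball a r. \<forall>h.
        norm ((\<Sum>k<N. \<Sum>i\<in>UNIV. h $ i * T i (\<sigma> k) x) - (\<Sum>i\<in>UNIV. h $ i * D i x)) \<le> e * norm h"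
      if "e > 0" for e
    proof -
      have "\<forall>\<^sub>F N in sequentially. \<forall>i\<in>UNIV. \<forall>x\<in>ball a r.
          dist (\<Sum>k<N. T i (\<sigma> k) x) (D i x) < e / CARD('n)"
        using unif that by (intro eventually_ball_finite) (auto simp: uniform_limit_iff)
      then show ?thesis
      proof eventually_elim
        case (elim N)
        show ?case
        proof (intro ballI allI)
          fix x h assume x: "x \<in> ball a r"
          have "(\<Sum>k<N. \<Sum>i\<in>UNIV. h $ i * T i (\<sigma> k) x) - (\<Sum>i\<in>UNIV. h $ i * D i x)
              = (\<Sum>i\<in>UNIV. h $ i * ((\<Sum>k<N. T i (\<sigma> k) x) - D i x))"
            by (subst sum.swap) (simp add: sum_subtractf sum_distrib_left right_diff_distrib)
          also have "norm \<dots> \<le> (\<Sum>i\<in>(UNIV::'n set). norm h * (e / CARD('n)))"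
          proof (intro sum_norm_le)
            fix i
            show "norm (h $ i * ((\<Sum>k<N. T i (\<sigma> k) x) - D i x)) \<le> norm h * (e / CARD('n))"
              using elim x component_le_norm_cart[of h i] unfolding norm_mult
              by (intro mult_mono) (auto simp: dist_norm less_imp_le)
          qed
          finally show "norm ((\<Sum>k<N. \<Sum>i\<in>UNIV. h $ i * T i (\<sigma> k) x) - (\<Sum>i\<in>UNIV. h $ i * D i x)) \<le> e * norm h"
            by (simp add: mult.commute)
        qed
      qed
    qed
    show "a \<in> ball a r" "convex (ball a r)"
      using r by auto
    show "(\<lambda>k. c (\<sigma> k) * monomial_fun (\<sigma> k) (a - a)) sums f a"
      using sums_f[of a] r by simp
  qed
  then obtain g where g: "\<And>x. x \<in> ball a r \<Longrightarrow> (\<lambda>k. c (\<sigma> k) * monomial_fun (\<sigma> k) (x - a)) sums g x"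
    "\<And>x. x \<in> ball a r \<Longrightarrow> (g has_derivative (\<lambda>h. \<Sum>i\<in>UNIV. h $ i * D i x)) (at x within ball a r)"
    by blast
  have "g x = f x" if "x \<in> ball a r" for x
    using g(1)[OF that] sums_f[OF that] by (rule sums_unique2)
  then have "(f has_derivative (\<lambda>h. \<Sum>i\<in>UNIV. h $ i * D i x)) (at x)" if "x \<in> ball a r" for x
    using g(2)[OF that] that at_within_open[OF that open_ball]
    by (intro has_derivative_transform_within_open[of g _ x UNIV "ball a r" f]) auto
  with r(1) D_series show ?thesis
    using that by blast
qed

lemma sum_axis_mult: "(\<Sum>j\<in>UNIV. axis i 1 $ j * g j) = g i" for g :: "'n::finite \<Rightarrow> real"
  by (subst sum.remove[of _ i]) (auto simp: axis_def)

lemma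
  fixes f :: "real^'n::finite \<Rightarrow> real"
  assumes "has_power_series_at f c a"
  shows has_power_series_at_has_derivative:
      "\<forall>\<^sub>F x in nhds a. (f has_derivative (\<lambda>h. \<Sum>i\<in>UNIV. h $ i * partial_deriv i f x)) (at x)"
    and has_power_series_at_partial_deriv:
      "has_power_series_at (partial_deriv i f) (\<lambda>\<beta>. real (\<beta> i + 1) * c (\<beta>(i := \<beta> i + 1))) a"
proof -
  obtain r D where r: "r > 0"
    and D: "\<And>x. x \<in> ball a r \<Longrightarrow> (f has_derivative (\<lambda>h. \<Sum>i\<in>UNIV. h $ i * D i x)) (at x)"
    and S: "\<And>x i. x \<in> ball a r \<Longrightarrow>
       ((\<lambda>\<beta>. real (\<beta> i + 1) * c (\<beta>(i := \<beta> i + 1)) * monomial_fun \<beta> (x - a)) has_sum D i x) UNIV"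
    using has_power_series_at_derivative_aux[OF assms] by blast
  have eq: "partial_deriv i f x = D i x" if "x \<in> ball a r" for i x
    using partial_deriv_eq_derivative_axis[OF D[OF that]] by (simp add: sum_axis_mult)
  show "\<forall>\<^sub>F x in nhds a. (f has_derivative (\<lambda>h. \<Sum>i\<in>UNIV. h $ i * partial_deriv i f x)) (at x)"
    using eventually_nhds_ball[OF r, of a] by eventually_elim (use D eq in simp)
  show "has_power_series_at (partial_deriv i f) (\<lambda>\<beta>. real (\<beta> i + 1) * c (\<beta>(i := \<beta> i + 1))) a"
    unfolding has_power_series_at_def using r S eq by auto
qed

section \<open>Hessians of rank one under affine coordinate changes\<close>

lemma partial_deriv_commute:
  assumes "real_analytic_at f a"
  shows "\<forall>\<^sub>F x in nhds a. partial_deriv j (partial_deriv i f) x = partial_deriv i (partial_deriv j f) x"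
proof -
  obtain c where c: "has_power_series_at f c a"
    using assms unfolding real_analytic_at_def by blast
  let ?d = "\<lambda>i c \<beta>. real (\<beta> i + 1) * c (\<beta>(i := \<beta> i + 1))"
  have P: "has_power_series_at (partial_deriv j (partial_deriv i f)) (?d j (?d i c)) a" for i j
    by (rule has_power_series_at_partial_deriv[OF has_power_series_at_partial_deriv[OF c]])
  have "?d j (?d i c) = ?d i (?d j c)"
    by (cases "i = j") (auto simp: fun_upd_twist)
  then have "has_power_series_at (partial_deriv i (partial_deriv j f)) (?d j (?d i c)) a"
    using P[of i j] by (simp only:)
  with P[of j i] obtain r1 r2 where r: "r1 > 0" "r2 > 0"
    and s: "\<And>x. x \<in> ball a r1 \<Longrightarrow> ((\<lambda>\<alpha>. ?d j (?d i c) \<alpha> * monomial_fun \<alpha> (x - a)) has_sum partial_deriv j (partial_deriv i f) x) UNIV"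
      "\<And>x. x \<in> ball a r2 \<Longrightarrow> ((\<lambda>\<alpha>. ?d j (?d i c) \<alpha> * monomial_fun \<alpha> (x - a)) has_sum partial_deriv i (partial_deriv j f) x) UNIV"
    unfolding has_power_series_at_def by blast
  show ?thesis
    using eventually_nhds_ball[OF r(1), of a] eventually_nhds_ball[OF r(2), of a]
    by eventually_elim (use s has_sum_unique in blast)
qed

lemma
  fixes f :: "real^'n::finite \<Rightarrow> real"
  assumes "real_analytic_at f a"
  shows real_analytic_at_has_derivative:
      "\<forall>\<^sub>F x in nhds a. (f has_derivative (\<lambda>h. \<Sum>i\<in>UNIV. h $ i * partial_deriv i f x)) (at x)"
    and real_analytic_at_partial_deriv_has_derivative:
      "\<forall>\<^sub>F x in nhds a. \<forall>i. (partial_deriv i f has_derivative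
         (\<lambda>h. \<Sum>j\<in>UNIV. h $ j * hessian f x $ i $ j)) (at x)"
    and real_analytic_at_hessian_symmetric:
      "\<forall>\<^sub>F x in nhds a. \<forall>i j. hessian f x $ i $ j = hessian f x $ j $ i"
proof -
  obtain c where c: "has_power_series_at f c a"
    using assms unfolding real_analytic_at_def by blast
  show "\<forall>\<^sub>F x in nhds a. (f has_derivative (\<lambda>h. \<Sum>i\<in>UNIV. h $ i * partial_deriv i f x)) (at x)"
    by (rule has_power_series_at_has_derivative[OF c])
  show "\<forall>\<^sub>F x in nhds a. \<forall>i. (partial_deriv i f has_derivative
         (\<lambda>h. \<Sum>j\<in>UNIV. h $ j * hessian f x $ i $ j)) (at x)"
    unfolding hessian_def
    using has_power_series_at_has_derivative[OF has_power_series_at_partial_deriv[OF c]]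
    by (simp add: eventually_all_finite)
  show "\<forall>\<^sub>F x in nhds a. \<forall>i j. hessian f x $ i $ j = hessian f x $ j $ i"
    unfolding hessian_def using partial_deriv_commute[OF assms]
    by (simp add: eventually_all_finite)
qed

text \<open>
  All later arguments use rank one only through this factorization, which bilinear substitutions preserve.
\<close>

lemma rank_eq_1_imp_outer_product:
  fixes A :: "real^'n::finite^'m::finite"
  assumes "rank A = 1"
  shows "\<exists>p q. \<forall>i j. A $ i $ j = p i * q j"
proof -
  obtain B where B: "rows A \<subseteq> span B" "card B = 1"
    using basis_exists[of "rows A"] assms by (metis row_rank_def)
  then obtain v where "B = {v}"
    by (auto simp: card_1_singleton_iff)
  have "\<exists>k. row i A = k *\<^sub>R v" for i
  proof -
    have "row i A \<in> rows A"
      by (auto simp: rows_def)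
    then show ?thesis
      using B \<open>B = {v}\<close> by (auto simp: span_singleton)
  qed
  then obtain p where "\<And>i. row i A = p i *\<^sub>R v"
    by metis
  then have "A $ i $ j = p i * v $ j" for i j
    by (metis row_def vec_lambda_eta vector_scaleR_component real_scaleR_def)
  then show ?thesis
    by blast
qed

lemma derivative_zero_if_locally_zero:
  assumes "(E has_derivative E') (at x)" "\<forall>\<^sub>F y in nhds x. E y = 0"
  shows "E' h = 0"
proof -
  have "\<forall>\<^sub>F y in at x. E y = 0" "E x = 0"
    using assms(2) by (auto simp: eventually_at_filter elim: eventually_mono dest: eventually_nhds_x_imp_x)
  with assms(1) have "((\<lambda>y. 0) has_derivative E') (at x)"
    by (intro has_derivative_transform_eventually[of E E' x UNIV "\<lambda>_. 0"]) auto
  from has_derivative_unique[OF this has_derivative_const] show ?thesis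
    by simp
qed

text \<open>
  If \<open>v \<mapsto> K v + k\<close> maps the graph of \<open>f\<close> into that of \<open>g\<close>, then differentiating this relation twice
  shows that the Hessian form of \<open>f\<close> is, up to a factor, the pullback of that of \<open>g\<close> under the
  differential of the induced map \<open>Y\<close> of the base points. The factor is \<open>1/\<theta>(0, 1)\<close>, where \<open>\<theta>\<close> is the
  conormal of the graph of \<open>g\<close> pulled back by \<open>K\<close>; it makes sense because \<open>\<theta>\<close> is a nonzero functional
  that already vanishes on the tangent space of the graph of \<open>f\<close>.
\<close>

lemma hessian_outer_product_transfer:
  fixes f g :: "real^'n::finite \<Rightarrow> real" and K :: "(real^'n) \<times> real \<Rightarrow> (real^'n) \<times> real"
  assumes K: "linear K" "surj K"
    and f: "real_analytic_at f a" and g: "real_analytic_at g (fst (K (a, f a) + k))"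
    and eq: "\<forall>\<^sub>F x in nhds a. snd (K (x, f x) + k) = g (fst (K (x, f x) + k))"
    and outer: "\<forall>\<^sub>F y in nhds (fst (K (a, f a) + k)). \<exists>p q. \<forall>i j. hessian g y $ i $ j = p i * q j"
  shows "\<forall>\<^sub>F x in nhds a. \<exists>p q. \<forall>i j. hessian f x $ i $ j = p i * q j"
proof -
  have bl: "bounded_linear K"
    using K(1) by (simp add: linear_conv_bounded_linear)
  define Y where "Y = (\<lambda>x. fst (K (x, f x) + k))"
  define df where "df = (\<lambda>x h. \<Sum>i\<in>UNIV. h $ i * partial_deriv i f x)"
  define dY where "dY = (\<lambda>x h. fst (K (h, df x h)))"
  have dK: "((\<lambda>x. K (x, f x) + k) has_derivative (\<lambda>h. K (h, df x h))) (at x)"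
    if "(f has_derivative df x) (at x)" for x
    using bounded_linear.has_derivative[OF bl has_derivative_Pair[OF has_derivative_ident that]]
    by (auto intro!: derivative_eq_intros)
  have dY: "(Y has_derivative dY x) (at x)" if "(f has_derivative df x) (at x)" for x
    unfolding Y_def dY_def by (rule has_derivative_fst[OF dK[OF that]])
  have ev_f: "\<forall>\<^sub>F x in nhds a. (f has_derivative df x) (at x)"
    using real_analytic_at_has_derivative[OF f] unfolding df_def .
  have "isCont Y a"
    using dY[OF eventually_nhds_x_imp_x[OF ev_f]] has_derivative_continuous by blast
  then have lim: "filterlim Y (nhds (fst (K (a, f a) + k))) (nhds a)"
    unfolding isCont_def tendsto_at_iff_tendsto_nhds by (simp add: Y_def)
  note ev_Y = eventually_compose_filterlim[OF _ lim]
  \<comment> \<open>Bundled so that it can be used at all points near \<open>x\<close>: the first-order relation is differentiated again.\<close>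
  define first_order where "first_order = (\<lambda>x. (f has_derivative df x) (at x) \<and> snd (K (x, f x) + k) = g (Y x) \<and>
      (g has_derivative (\<lambda>h. \<Sum>i\<in>UNIV. h $ i * partial_deriv i g (Y x))) (at (Y x)))"
  have "\<forall>\<^sub>F x in nhds a. first_order x"
    unfolding first_order_def
    using ev_f eq[folded Y_def] ev_Y[OF real_analytic_at_has_derivative[OF g]]
    by eventually_elim (simp add: Y_def)
  then have ev_first: "\<forall>\<^sub>F x in nhds a. \<forall>\<^sub>F x' in nhds x. first_order x'"
    by (simp add: eventually_eventually)
  from ev_first real_analytic_at_partial_deriv_has_derivative[OF f]
    ev_Y[OF real_analytic_at_partial_deriv_has_derivative[OF g]] ev_Y[OF outer]
  show ?thesis
  proof eventually_elim
    case (elim x)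
    have tangent: "snd (K (h, df x' h)) - (\<Sum>i\<in>UNIV. partial_deriv i g (Y x') * dY x' h $ i) = 0"
      if near: "\<forall>\<^sub>F x'' in nhds x'. first_order x''" for x' h
    proof -
      have 1: "first_order x'"
        by (rule eventually_nhds_x_imp_x[OF near])
      then have "((\<lambda>x. snd (K (x, f x) + k)) has_derivative (\<lambda>h. snd (K (h, df x' h)))) (at x')"
        unfolding first_order_def by (intro has_derivative_snd dK) auto
      moreover have "((\<lambda>x. g (Y x)) has_derivative (\<lambda>h. \<Sum>i\<in>UNIV. dY x' h $ i * partial_deriv i g (Y x'))) (at x')"
        using 1 diff_chain_at[of Y "dY x'" x' g] dY unfolding first_order_def o_def by blast
      ultimately have "((\<lambda>x. snd (K (x, f x) + k) - g (Y x)) has_derivative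
          (\<lambda>h. snd (K (h, df x' h)) - (\<Sum>i\<in>UNIV. dY x' h $ i * partial_deriv i g (Y x')))) (at x')"
        by (rule has_derivative_diff)
      moreover have "\<forall>\<^sub>F x in nhds x'. snd (K (x, f x) + k) - g (Y x) = 0"
        using near by eventually_elim (simp add: first_order_def)
      ultimately show ?thesis
        using derivative_zero_if_locally_zero[of _ _ x' h] by (fastforce simp: mult.commute)
    qed
    have 1: "first_order x"
      using eventually_nhds_x_imp_x[OF elim(1)] .
    define B where "B = (\<lambda>h w. \<Sum>j\<in>UNIV. h $ j * (\<Sum>l\<in>UNIV. w $ l * hessian f x $ j $ l))"
    have df: "((\<lambda>x. df x h) has_derivative B h) (at x)" for h
      unfolding df_def B_def using elim(2) by (intro has_derivative_sum has_derivative_mult_right) auto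
    have dYh: "((\<lambda>x. K (h, df x h)) has_derivative (\<lambda>w. K (0, B h w))) (at x)" for h
      by (rule bounded_linear.has_derivative[OF bl has_derivative_Pair[OF has_derivative_const df]])
    have dgY: "((\<lambda>x. partial_deriv i g (Y x)) has_derivative
        (\<lambda>w. \<Sum>l\<in>UNIV. dY x w $ l * hessian g (Y x) $ i $ l)) (at x)" for i
      using diff_chain_at[of Y "dY x" x "partial_deriv i g"] dY 1 elim(3)
      unfolding first_order_def o_def by blast
    define \<theta> where "\<theta> = (\<lambda>v. snd (K v) - (\<Sum>i\<in>UNIV. partial_deriv i g (Y x) * fst (K v) $ i))"
    \<comment> \<open>\<open>B\<close> is the Hessian form of \<open>f\<close> at \<open>x\<close>.\<close>
    have second: "\<theta> (0, B h w) = (\<Sum>i\<in>UNIV. (\<Sum>l\<in>UNIV. dY x w $ l * hessian g (Y x) $ i $ l) * dY x h $ i)" for h w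
    proof -
      have "((\<lambda>x. dY x h $ i) has_derivative (\<lambda>w. fst (K (0, B h w)) $ i)) (at x)" for i
        unfolding dY_def
        by (rule bounded_linear.has_derivative[OF bounded_linear_vec_nth has_derivative_fst[OF dYh]])
      then have "((\<lambda>x. snd (K (h, df x h)) - (\<Sum>i\<in>UNIV. partial_deriv i g (Y x) * dY x h $ i)) has_derivative
          (\<lambda>w. snd (K (0, B h w)) - (\<Sum>i\<in>UNIV. partial_deriv i g (Y x) * fst (K (0, B h w)) $ i
             + (\<Sum>l\<in>UNIV. dY x w $ l * hessian g (Y x) $ i $ l) * dY x h $ i))) (at x)"
        by (intro has_derivative_diff has_derivative_snd[OF dYh] has_derivative_sum has_derivative_mult dgY)
      moreover have "\<forall>\<^sub>F x' in nhds x. snd (K (h, df x' h)) - (\<Sum>i\<in>UNIV. partial_deriv i g (Y x') * dY x' h $ i) = 0"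
        using elim(1) tangent by (subst (asm) eventually_eventually[symmetric]) (auto elim: eventually_mono)
      ultimately have "snd (K (0, B h w)) - (\<Sum>i\<in>UNIV. partial_deriv i g (Y x) * fst (K (0, B h w)) $ i
             + (\<Sum>l\<in>UNIV. dY x w $ l * hessian g (Y x) $ i $ l) * dY x h $ i) = 0"
        by (rule derivative_zero_if_locally_zero)
      then show ?thesis
        by (simp add: \<theta>_def sum.distrib)
    qed
    have "linear \<theta>"
      unfolding \<theta>_def using K(1)
      by (intro linearI) (auto simp: linear_add linear_scale algebra_simps sum.distrib sum_distrib_left)
    have \<theta>_scale: "\<theta> (0, t) = t * \<theta> (0, 1)" for t
      using linear_scale[OF \<open>linear \<theta>\<close>, of t "(0, 1)"] by simp
    have \<theta>_tangent: "\<theta> (h, df x h) = 0" for h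
      using tangent[OF elim(1), of h] unfolding \<theta>_def dY_def .
    have "\<theta> (0, 1) \<noteq> 0"
    proof
      assume "\<theta> (0, 1) = 0"
      then have "\<theta> (h, t) = 0" for h t
        using linear_add[OF \<open>linear \<theta>\<close>, of "(h, df x h)" "(0, t - df x h)"]
          \<theta>_tangent[of h] \<theta>_scale[of "t - df x h"] by simp
      moreover obtain v where "K v = (0, 1)"
        using K(2) by (metis surjD)
      ultimately show False
        using \<theta>_def by (metis (no_types, lifting) diff_zero fst_conv mult_zero_right old.prod.exhaust
            snd_conv sum.neutral zero_index zero_neq_one)
    qed
    from elim(4) obtain p q where pq: "\<And>i j. hessian g (Y x) $ i $ j = p i * q j"
      unfolding Y_def by blast
    define u where "u = (\<lambda>i. (\<Sum>m\<in>UNIV. p m * dY x (axis i 1) $ m) / \<theta> (0, 1))"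
    define v where "v = (\<lambda>j. \<Sum>l\<in>UNIV. q l * dY x (axis j 1) $ l)"
    have "hessian f x $ i $ j = u i * v j" for i j
    proof -
      have "B (axis i 1) (axis j 1) = hessian f x $ i $ j"
        by (simp add: B_def sum_axis_mult)
      then have "hessian f x $ i $ j * \<theta> (0, 1) = \<theta> (0, B (axis i 1) (axis j 1))"
        using \<theta>_scale[of "hessian f x $ i $ j"] by (simp only:)
      also have "\<dots> = (\<Sum>m\<in>UNIV. p m * dY x (axis i 1) $ m) * v j"
        unfolding second pq v_def sum_product
        by (simp add: sum_distrib_left sum_distrib_right mult_ac)
      finally show ?thesis
        using \<open>\<theta> (0, 1) \<noteq> 0\<close> by (simp add: u_def field_simps)
    qed
    then show ?case
      by (intro exI[of _ u] exI[of _ v]) simp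
  qed
qed

section \<open>Power series along a coordinate axis\<close>

text \<open>
  On an axis every monomial involving another variable vanishes, so the series in several variables
  becomes the series of its pure coefficients in one variable.
\<close>

lemma has_fps_expansion_on_axis:
  assumes "has_power_series_at f c (0 :: real^'n::finite)"
  shows "(\<lambda>x. f (x *\<^sub>R axis j 1)) has_fps_expansion Abs_fps (\<lambda>k. c (\<lambda>i. if i = j then k else 0))"
proof (rule has_fps_expansionI)
  obtain r where r: "r > 0" and s: "\<And>x. x \<in> ball 0 r \<Longrightarrow> ((\<lambda>\<alpha>. c \<alpha> * monomial_fun \<alpha> x) has_sum f x) UNIV"
    using assms unfolding has_power_series_at_def by auto
  let ?h = "\<lambda>k i. if i = j then k else (0::nat)"
  show "\<forall>\<^sub>F x in nhds 0. (\<lambda>k. fps_nth (Abs_fps (\<lambda>k. c (?h k))) k * x ^ k) sums f (x *\<^sub>R axis j 1)"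
    using eventually_nhds_ball[OF r, of 0]
  proof eventually_elim
    case (elim x)
    have mono: "monomial_fun (?h k) (x *\<^sub>R axis j 1) = x ^ k" for k
      unfolding monomial_fun_def by (subst prod.remove[of _ j]) (auto simp: axis_def)
    have zero: "monomial_fun \<alpha> (x *\<^sub>R axis j 1) = 0" if "\<alpha> \<notin> range ?h" for \<alpha>
    proof -
      have "\<alpha> \<noteq> ?h (\<alpha> j)"
        using that by blast
      then obtain i where "i \<noteq> j" "\<alpha> i \<noteq> 0"
        by (auto simp: fun_eq_iff split: if_splits)
      then show ?thesis
        unfolding monomial_fun_def by (intro prod_zero) (auto simp: axis_def intro!: bexI[of _ i])
    qed
    have "((\<lambda>\<alpha>. c \<alpha> * monomial_fun \<alpha> (x *\<^sub>R axis j 1)) has_sum f (x *\<^sub>R axis j 1)) UNIV"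
      using elim by (intro s) simp
    then have "((\<lambda>\<alpha>. c \<alpha> * monomial_fun \<alpha> (x *\<^sub>R axis j 1)) has_sum f (x *\<^sub>R axis j 1)) (range ?h)"
      by (subst has_sum_cong_neutral[where T = UNIV]) (auto simp: zero)
    moreover have "inj ?h"
      by (rule injI) (metis (full_types))
    ultimately have "((\<lambda>k. c (?h k) * x ^ k) has_sum f (x *\<^sub>R axis j 1)) UNIV"
      by (simp add: has_sum_reindex o_def mono)
    then show ?case
      by (auto dest: has_sum_imp_sums)
  qed
qed


section \<open>Symmetries of a curve with independent derivatives\<close>

context
  includes fps_syntax and no vec_syntax
begin

lemma has_fps_expansion_unique_real:
  fixes F G :: "real fps"
  assumes "f has_fps_expansion F" "f has_fps_expansion G"
  shows "F = G"
proof (rule ccontr)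
  assume "F \<noteq> G"
  define D where "D = F - G"
  let ?g = "\<lambda>x::real. if x = 0 then D $ subdegree D else 0 / x ^ subdegree D"
  have "(\<lambda>_. 0) has_fps_expansion D"
    using has_fps_expansion_diff[OF assms] by (simp add: D_def)
  then have "?g has_fps_expansion fps_shift (subdegree D) D"
    by (intro has_fps_expansion_shift) auto
  then have "isCont ?g 0"
    by (rule has_fps_expansion_imp_continuous)
  then have "(?g \<longlongrightarrow> ?g 0) (at 0)"
    by (simp only: isCont_def)
  then have "((\<lambda>_::real. 0::real) \<longlongrightarrow> ?g 0) (at 0)"
    by (rule Lim_transform_eventually) (auto simp: eventually_at_filter)
  then have "D $ subdegree D = 0"
    by (simp add: tendsto_const_iff del: nth_subdegree_zero_iff)
  with \<open>F \<noteq> G\<close> show False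
    using nth_subdegree_nonzero[of D] by (simp add: D_def)
qed

lemma has_fps_expansion_eqD:
  fixes F G :: "real fps"
  assumes "f has_fps_expansion F" "g has_fps_expansion G" "\<forall>\<^sub>F x in nhds 0. f x = g x"
  shows "F = G"
proof -
  have "f has_fps_expansion G"
    using assms(2,3) unfolding has_fps_expansion_def by (auto elim: eventually_elim2)
  with assms(1) show ?thesis
    by (rule has_fps_expansion_unique_real)
qed

lemma fps_mult_nth_below:
  fixes f g :: "'a::comm_ring_1 fps"
  assumes "\<And>i. i < a \<Longrightarrow> f $ i = 0" "\<And>i. i < b \<Longrightarrow> g $ i = 0" "k < a + b"
  shows "(f * g) $ k = 0"
  unfolding fps_mult_nth
proof (intro sum.neutral ballI)
  fix i assume "i \<in> {0..k}"
  with assms(3) have "i < a \<or> k - i < b"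
    by auto
  then show "f $ i * g $ (k - i) = 0"
    using assms by auto
qed

lemma fps_mult_nth_lowest:
  fixes f g :: "'a::comm_ring_1 fps"
  assumes "\<And>i. i < a \<Longrightarrow> f $ i = 0" "\<And>i. i < b \<Longrightarrow> g $ i = 0"
  shows "(f * g) $ (a + b) = f $ a * g $ b"
proof -
  have "f $ i * g $ (a + b - i) = 0" if "i \<in> {0..a + b} - {a}" for i
  proof -
    have "i < a \<or> a + b - i < b"
      using that by auto
    then show ?thesis
      using assms by auto
  qed
  then have "(\<Sum>i=0..a + b. f $ i * g $ (a + b - i)) = f $ a * g $ (a + b - a)"
    by (subst sum.remove[of _ a]) auto
  then show ?thesis
    by (simp add: fps_mult_nth)
qed

text \<open>
  Comparing coefficients of \<open>P \<gamma> = \<lambda> \<gamma> + \<mu> \<gamma>'\<close> shows that \<open>P j k\<close> vanishes for \<open>k < j + d\<close> if \<open>\<lambda>\<close>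
  and \<open>\<mu>\<close> vanish to order \<open>d\<close> and \<open>d + 1\<close>. With \<open>d = 1\<close> the last row of \<open>P\<close> is zero, and the
  coefficient of \<open>x\<^sup>n\<^sup>+\<^sup>1\<close> in that row, where no unknown higher coefficient of \<open>\<gamma>\<close> enters, gives
  \<open>\<lambda>'(0) = 0\<close>. With \<open>d = 2\<close> the last two rows are zero: two equations for \<open>\<lambda>\<close> and \<open>\<mu>\<close> whose
  determinant is the Wronskian of \<open>\<gamma>\<^sub>n\<^sub>-\<^sub>1\<close> and \<open>\<gamma>\<^sub>n\<close>. It is a nonzero power series, so \<open>\<lambda> = \<mu> = 0\<close>
  and \<open>P \<gamma> = 0\<close>, which forces \<open>P = 0\<close> since the components of \<open>\<gamma>\<close> are independent.
\<close>

lemma osculating_curve_symmetry_trivial: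
  fixes G :: "nat \<Rightarrow> real fps" and P :: "nat \<Rightarrow> nat \<Rightarrow> real" and l m :: "real fps"
  assumes n: "2 \<le> n"
    and G: "\<And>j k. j \<le> n \<Longrightarrow> k \<le> n \<Longrightarrow> G j $ k = (if j = k then 1 / fact k else 0)"
    and eq: "\<And>j. j \<le> n \<Longrightarrow> (\<Sum>i\<le>n. fps_const (P j i) * G i) = l * G j + m * fps_deriv (G j)"
    and l0: "l $ 0 = 0" and m0: "m $ 0 = 0" "m $ 1 = 0" "m $ 2 = 0"
    and "j \<le> n" "i \<le> n"
  shows "P j i = 0"
proof -
  have G_low: "G j $ i = 0" if "j \<le> n" "i < j" for i j
    using G[of j i] that by simp
  have dG_low: "fps_deriv (G j) $ i = 0" if "j \<le> n" "i < j - 1" for i j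
    using G_low[of j "i + 1"] that by simp
  have coeff: "(\<Sum>i\<le>n. fps_const (P j i) * G i) $ k = P j k / fact k" if "k \<le> n" for j k
  proof -
    have "(\<Sum>i\<le>n. fps_const (P j i) * G i) $ k = (\<Sum>i\<le>n. if i = k then P j k / fact k else 0)"
      unfolding fps_sum_nth using G that by (intro sum.cong) auto
    then show ?thesis
      using that by simp
  qed
  have row: "P j k = 0"
    if "\<And>i. i < d \<Longrightarrow> l $ i = 0" "\<And>i. i < d + 1 \<Longrightarrow> m $ i = 0" "j \<le> n" "k \<le> n" "k < j + d" for d j k
  proof -
    have "(l * G j) $ k = 0"
      using that G_low[of j] by (intro fps_mult_nth_below[of d _ j]) auto
    moreover have "(m * fps_deriv (G j)) $ k = 0"
      using that dG_low[of j] by (intro fps_mult_nth_below[of "d + 1" _ "j - 1"]) auto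
    ultimately have "P j k / fact k = 0"
      using eq[OF \<open>j \<le> n\<close>] coeff[OF \<open>k \<le> n\<close>, of j] by simp
    then show ?thesis
      by simp
  qed
  have vanish: "l * G j + m * fps_deriv (G j) = 0" if "j \<le> n" "\<And>k. k \<le> n \<Longrightarrow> P j k = 0" for j
    using eq[OF that(1)] that(2) by simp
  have l1: "l $ 1 = 0"
  proof -
    have "P n k = 0" if "k \<le> n" for k
      using that l0 m0 by (intro row[of 1]) (auto simp: less_Suc_eq numeral_2_eq_2)
    from vanish[OF _ this] have "l * G n + m * fps_deriv (G n) = 0"
      by simp
    moreover have "1 + n = 2 + (n - 1)"
      using n by simp
    ultimately have "(l * G n) $ (1 + n) + (m * fps_deriv (G n)) $ (2 + (n - 1)) = 0"
      by (metis fps_add_nth fps_zero_nth)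
    moreover have "(l * G n) $ (1 + n) = l $ 1 * G n $ n"
      using l0 G_low[of n] by (intro fps_mult_nth_lowest) auto
    moreover have "(m * fps_deriv (G n)) $ (2 + (n - 1)) = m $ 2 * fps_deriv (G n) $ (n - 1)"
      using m0 dG_low[of n] by (intro fps_mult_nth_lowest) (auto simp: less_Suc_eq numeral_2_eq_2)
    ultimately show ?thesis
      using m0 G[of n n] by simp
  qed
  have rows: "P j k = 0" if "n - 1 \<le> j" "j \<le> n" "k \<le> n" for j k
    using that l0 l1 m0 n by (intro row[of 2]) (auto simp: less_Suc_eq numeral_2_eq_2 numeral_3_eq_3)
  have e: "l * G n + m * fps_deriv (G n) = 0"
    by (rule vanish) (auto intro: rows)
  have e': "l * G (n - 1) + m * fps_deriv (G (n - 1)) = 0"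
    by (rule vanish) (auto intro: rows)
  \<comment> \<open>The lowest coefficient of the Wronskian is \<open>1/((n-1)! n!)\<close>, at \<open>x\<^bsup>2n-2\<^esup>\<close>.\<close>
  define W where "W = G (n - 1) * fps_deriv (G n) - G n * fps_deriv (G (n - 1))"
  have "m * W = G (n - 1) * (l * G n + m * fps_deriv (G n)) - G n * (l * G (n - 1) + m * fps_deriv (G (n - 1)))"
    by (simp add: W_def algebra_simps)
  then have "m * W = 0"
    unfolding e e' by simp
  moreover have "W \<noteq> 0"
  proof -
    have "(G (n - 1) * fps_deriv (G n)) $ ((n - 1) + (n - 1)) = G (n - 1) $ (n - 1) * fps_deriv (G n) $ (n - 1)"
      using G_low[of "n - 1"] dG_low[of n] by (intro fps_mult_nth_lowest) auto
    moreover have "(G n * fps_deriv (G (n - 1))) $ (n + (n - 2)) = G n $ n * fps_deriv (G (n - 1)) $ (n - 2)"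
      using G_low[of n] dG_low[of "n - 1"] by (intro fps_mult_nth_lowest) auto
    moreover have "n + (n - 2) = (n - 1) + (n - 1)"
      using n by simp
    ultimately have "W $ ((n - 1) + (n - 1)) = G (n - 1) $ (n - 1) * fps_deriv (G n) $ (n - 1)
        - G n $ n * fps_deriv (G (n - 1)) $ (n - 2)"
      unfolding W_def by simp
    also have "\<dots> = real n / (fact (n - 1) * fact n) - real (n - 1) / (fact (n - 1) * fact n)"
      using G[of n n] G[of "n - 1" "n - 1"] n by (simp add: Suc_diff_Suc numeral_2_eq_2 of_nat_diff)
    also have "\<dots> = 1 / (fact (n - 1) * fact n)"
      using n by (simp add: diff_divide_distrib[symmetric] of_nat_diff)
    finally show ?thesis
      by auto
  qed
  ultimately have "m = 0"
    by simp
  moreover have "G n \<noteq> 0"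
    using G[of n n] by auto
  ultimately have "l = 0"
    using e by simp
  show ?thesis
    using eq[OF \<open>j \<le> n\<close>] coeff[OF \<open>i \<le> n\<close>, of j] \<open>m = 0\<close> \<open>l = 0\<close> by simp
qed

end

section \<open>The conormal curve of the normal form\<close>

text \<open>
  At a point of the \<open>x\<^sub>1\<close>-axis only the terms of degree at most one in \<open>x\<^sub>2, \<dots>, x\<^sub>n\<close>
  contribute to a first derivative;
  the quadratic terms are collected in a multiple \<open>C\<close> of \<open>t\<^sup>2\<close>.
\<close>

lemma normal_form_part_line_derivative:
  fixes e :: "nat \<Rightarrow> 'n::finite"
  assumes e: "bij_betw e {1..CARD('n)} UNIV" and j: "1 \<le> j" "j \<le> CARD('n)" and n: "2 \<le> CARD('n)"
  shows "((\<lambda>t. normal_form_part e (x *\<^sub>R axis (e 1) 1 + t *\<^sub>R axis (e j) 1))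
           has_field_derivative x ^ j / fact j) (at 0)"
proof -
  let ?n = "CARD('n)"
  define Y where "Y = (\<lambda>t. x *\<^sub>R axis (e 1) 1 + t *\<^sub>R axis (e j) (1::real))"
  have e_eq: "e i = e k \<longleftrightarrow> i = k" if "i \<in> {1..?n}" "k \<in> {1..?n}" for i k
    using inj_on_eq_iff[OF bij_betw_imp_inj_on[OF e] that] .
  define \<delta> where "\<delta> = (\<lambda>m. if m = j then 1 else (0::real))"
  have y: "Y t $ e m = t * \<delta> m" if "2 \<le> m" "m \<le> ?n" for t m
    using e_eq[of m 1] e_eq[of m j] that j by (auto simp: Y_def axis_def \<delta>_def)
  have y1: "Y t $ e 1 = x + t * \<delta> 1" for t
    using e_eq[of 1 j] j by (auto simp: Y_def axis_def \<delta>_def)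
  let ?I = "\<lambda>m. {(i, k). 2 \<le> i \<and> i \<le> ?n \<and> 2 \<le> k \<and> k \<le> ?n \<and> i + k = m + 1}"
  have quadratic: "(\<Sum>(i, k) \<in> ?I m. 1/2 * ((Y t $ e i) * (Y t $ e k) / (fact (i - 1) * fact (k - 1))))
      = t ^ 2 * (\<Sum>(i, k) \<in> ?I m. 1/2 * (\<delta> i * \<delta> k / (fact (i - 1) * fact (k - 1))))" for t m
    unfolding sum_distrib_left
    by (rule sum.cong) (auto simp: y power2_eq_square)
  have N: "normal_form_part e (Y t) = (x + t * \<delta> 1)^2 / 2 + (x + t * \<delta> 1)^2 * (t * \<delta> 2) / 2
     + (\<Sum>m = 3..?n. (x + t * \<delta> 1)^m * (t * \<delta> m) / fact m + (x + t * \<delta> 1)^(m - 1) *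
        (t ^ 2 * (\<Sum>(i, k) \<in> ?I m. 1/2 * (\<delta> i * \<delta> k / (fact (i - 1) * fact (k - 1))))))" for t
    unfolding normal_form_part_def y1 quadratic using n
    by (simp add: y)
  have "((\<lambda>t. normal_form_part e (Y t)) has_field_derivative x ^ j / fact j) (at 0)"
  proof (cases "j = 1")
    case True
    have "(\<Sum>(i, k) \<in> ?I m. 1/2 * (\<delta> i * \<delta> k / (fact (i - 1) * fact (k - 1)))) = 0" for m
      by (rule sum.neutral) (auto simp: \<delta>_def True)
    then have "(\<lambda>t. normal_form_part e (Y t)) = (\<lambda>t. (x + t)^2 / 2)"
      unfolding N by (simp add: \<delta>_def True)
    then show ?thesis
      by (auto simp: True intro!: derivative_eq_intros)
  next
    case False
    define C where "C = (\<Sum>m = 3..?n. x^(m - 1) *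
        (\<Sum>(i, k) \<in> ?I m. 1/2 * (\<delta> i * \<delta> k / (fact (i - 1) * fact (k - 1)))))"
    have lin: "x^2 * \<delta> 2 / 2 + (\<Sum>m = 3..?n. x^m * \<delta> m / fact m) = x ^ j / fact j"
    proof -
      have "(\<Sum>m = 3..?n. x^m * \<delta> m / fact m) = (\<Sum>m = 3..?n. if m = j then x ^ j / fact j else 0)"
        by (rule sum.cong) (auto simp: \<delta>_def)
      then show ?thesis
        using j False by (cases "j = 2") (auto simp: \<delta>_def fact_2)
    qed
    have "normal_form_part e (Y t) = x^2 / 2 + t * (x ^ j / fact j) + t ^ 2 * C" for t
      unfolding N lin[symmetric] C_def using False
      by (simp add: \<delta>_def sum.distrib sum_distrib_left distrib_left mult_ac)
    then have "(\<lambda>t. normal_form_part e (Y t)) = (\<lambda>t. x^2 / 2 + t * (x ^ j / fact j) + t ^ 2 * C)"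
      by (rule ext)
    then show ?thesis
      by (auto intro!: derivative_eq_intros)
  qed
  then show ?thesis
    unfolding Y_def .
qed

text \<open>
  The \<open>k\<close>-th coefficient of \<open>\<partial>\<^sub>j f\<close> on the axis \<open>a\<close> comes from the monomial \<open>x\<^sub>a\<^sup>k x\<^sub>j\<close> of \<open>f\<close>. The sum in the
  hypothesis is the degree of this monomial in the variables \<open>J\<close>: if it is below \<open>\<kappa>\<close>, the monomial is
  absent.
\<close>

lemma big_O_vars_partial_deriv_on_axis:
  fixes f :: "real^'n::finite \<Rightarrow> real"
  assumes f: "f \<in> big_O_vars J \<kappa>"
    and small: "\<And>k. k \<le> N \<Longrightarrow> (\<Sum>i\<in>J. if i = a then k else 0) + (if j \<in> J then 1 else 0) < \<kappa>"
  obtains G where "(\<lambda>x. partial_deriv j f (x *\<^sub>R axis a 1)) has_fps_expansion G"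
    "\<And>k. k \<le> N \<Longrightarrow> fps_nth G k = 0" "real_analytic_at f 0"
proof -
  obtain c where c: "has_power_series_at f c 0" and low: "\<And>\<alpha>. c \<alpha> \<noteq> 0 \<Longrightarrow> \<kappa> \<le> (\<Sum>i\<in>J. \<alpha> i)"
    using f unfolding big_O_vars_def by blast
  let ?h = "\<lambda>k i. if i = a then k else (0::nat)"
  let ?d = "\<lambda>\<beta>. real (\<beta> j + 1) * c (\<beta>(j := \<beta> j + 1))"
  have "c ((?h k)(j := ?h k j + 1)) = 0" if "k \<le> N" for k
  proof (rule ccontr)
    assume "c ((?h k)(j := ?h k j + 1)) \<noteq> 0"
    then have "\<kappa> \<le> (\<Sum>i\<in>J. ((?h k)(j := ?h k j + 1)) i)"
      by (rule low)
    also have "\<dots> = (\<Sum>i\<in>J. ?h k i + (if i = j then 1 else 0))"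
      by (rule sum.cong) auto
    also have "\<dots> < \<kappa>"
      using small[OF that] by (simp add: sum.distrib)
    finally show False
      by simp
  qed
  then have "fps_nth (Abs_fps (\<lambda>k. ?d (?h k))) k = 0" if "k \<le> N" for k
    using that by simp
  with has_fps_expansion_on_axis[OF has_power_series_at_partial_deriv[OF c], of j a] show thesis
    using that c unfolding real_analytic_at_def by blast
qed

lemma filterlim_axis: "filterlim (\<lambda>x. x *\<^sub>R axis a 1) (nhds (0 :: real^'n::finite)) (nhds (0::real))"
proof -
  have "((\<lambda>x. x *\<^sub>R axis a 1) \<longlongrightarrow> 0 *\<^sub>R (axis a 1 :: real^'n)) (nhds (0::real))"
    by (intro tendsto_scaleR filterlim_ident tendsto_const)
  then show ?thesis
    by simp
qed

text \<open>
  Neither remainder is visible up to order \<open>n\<close>: a monomial of degree at least \<open>3\<close> in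
  \<open>x\<^sub>2, \<dots>, x\<^sub>n\<close> keeps degree at least \<open>2\<close> in them after one differentiation and vanishes on the
  axis, and one of total degree at least \<open>n + 2\<close> contributes from \<open>x\<^sup>n\<^sup>+\<^sup>1\<close> on.
\<close>

lemma nondegenerate_gradient_on_axis:
  fixes F :: "real^'n::finite \<Rightarrow> real"
  assumes e: "bij_betw e {1..CARD('n)} UNIV" and n: "2 \<le> CARD('n)"
    and R: "R \<in> big_O_vars (e ` {2..CARD('n)}) 3" and S: "S \<in> big_O_vars UNIV (CARD('n) + 2)"
    and F: "\<forall>\<^sub>F x in nhds 0. F x = normal_form_part e x + R x + S x"
    and j: "1 \<le> j" "j \<le> CARD('n)"
  shows "\<exists>G. (\<lambda>x. partial_deriv (e j) F (x *\<^sub>R axis (e 1) 1)) has_fps_expansion G \<and>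
    (\<forall>k\<le>CARD('n). fps_nth G k = (if k = j then 1 / fact k else 0))"
proof -
  let ?n = "CARD('n)"
  have "e 1 \<noteq> e m" if "m \<in> {2..?n}" for m
    using inj_on_eq_iff[OF bij_betw_imp_inj_on[OF e], of 1 m] that n by auto
  then have "i \<noteq> e 1" if "i \<in> e ` {2..?n}" for i
    using that by (metis imageE)
  then have "(\<Sum>i\<in>e ` {2..?n}. if i = e 1 then k else 0) = 0" for k :: nat
    by (intro sum.neutral) simp
  then have "(\<Sum>i\<in>e ` {2..?n}. if i = e 1 then k else 0) + (if e j \<in> e ` {2..?n} then 1 else 0) < 3" for k :: nat
    by (simp del: One_nat_def)
  from big_O_vars_partial_deriv_on_axis[OF R this, where N = ?n]
  obtain GR where GR: "(\<lambda>x. partial_deriv (e j) R (x *\<^sub>R axis (e 1) 1)) has_fps_expansion GR"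
    "\<And>k. k \<le> ?n \<Longrightarrow> fps_nth GR k = 0" and anR: "real_analytic_at R 0"
    by blast
  have "(\<Sum>i\<in>UNIV. if i = e 1 then k else 0) + (if e j \<in> UNIV then 1 else 0) < ?n + 2" if "k \<le> ?n" for k
    using that by simp
  from big_O_vars_partial_deriv_on_axis[OF S this]
  obtain GS where GS: "(\<lambda>x. partial_deriv (e j) S (x *\<^sub>R axis (e 1) 1)) has_fps_expansion GS"
    "\<And>k. k \<le> ?n \<Longrightarrow> fps_nth GS k = 0" and anS: "real_analytic_at S 0"
    by blast
  define G where "G = fps_const (1 / fact j) * fps_X ^ j + GR + GS"
  let ?f = "\<lambda>x. 1 / fact j * x ^ j + partial_deriv (e j) R (x *\<^sub>R axis (e 1) 1) + partial_deriv (e j) S (x *\<^sub>R axis (e 1) 1)"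
  have "?f has_fps_expansion G"
    unfolding G_def by (intro fps_expansion_intros GR GS)
  moreover have "\<forall>\<^sub>F x in nhds 0. partial_deriv (e j) F (x *\<^sub>R axis (e 1) 1) = ?f x"
  proof -
    have "\<forall>\<^sub>F X in nhds (0::real^'n). \<forall>\<^sub>F x in nhds X. F x = normal_form_part e x + R x + S x"
      using F by (simp add: eventually_eventually)
    from eventually_compose_filterlim[OF this filterlim_axis[of "e 1"]]
      eventually_compose_filterlim[OF real_analytic_at_has_derivative[OF anR] filterlim_axis[of "e 1"]]
      eventually_compose_filterlim[OF real_analytic_at_has_derivative[OF anS] filterlim_axis[of "e 1"]]
    show ?thesis
    proof eventually_elim
      case (elim x)
      let ?L = "\<lambda>t. x *\<^sub>R axis (e 1) 1 + t *\<^sub>R axis (e j) (1::real)"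
      have "((\<lambda>t. normal_form_part e (?L t) + R (?L t) + S (?L t)) has_field_derivative ?f x) (at 0)"
        using normal_form_part_line_derivative[OF e j n, of x]
          has_derivative_imp_line_derivative[OF elim(2), of "axis (e j) 1"]
          has_derivative_imp_line_derivative[OF elim(3), of "axis (e j) 1"]
        by (auto simp: sum_axis_mult intro!: DERIV_add)
      moreover have "\<forall>\<^sub>F t in nhds 0. F (?L t) = normal_form_part e (?L t) + R (?L t) + S (?L t)"
      proof (rule eventually_compose_filterlim[OF elim(1)])
        have "(?L \<longlongrightarrow> x *\<^sub>R axis (e 1) 1 + 0 *\<^sub>R axis (e j) 1) (nhds 0)"
          by (intro tendsto_add tendsto_scaleR tendsto_const filterlim_ident)
        then show "filterlim ?L (nhds (x *\<^sub>R axis (e 1) 1)) (nhds 0)"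
          by simp
      qed
      ultimately have "((\<lambda>t. F (?L t)) has_field_derivative ?f x) (at 0)"
        by (subst DERIV_cong_ev[OF refl _ refl])
      then show ?case
        unfolding partial_deriv_def by (rule DERIV_imp_deriv)
    qed
  qed
  ultimately have "(\<lambda>x. partial_deriv (e j) F (x *\<^sub>R axis (e 1) 1)) has_fps_expansion G"
    unfolding has_fps_expansion_def by (auto elim: eventually_elim2)
  moreover have "fps_nth G k = (if k = j then 1 / fact k else 0)" if "k \<le> ?n" for k
    using that by (simp add: G_def GR GS fps_X_power_nth)
  ultimately show ?thesis
    by blast
qed


section \<open>Tangent affine fields and the conormal curve\<close>

definition tangent_to_graph ::
    "(real^'n::finite \<Rightarrow> real) \<Rightarrow> real^'n \<Rightarrow> ((real^'n) \<times> real \<Rightarrow> (real^'n) \<times> real) \<Rightarrow> bool" where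
  "tangent_to_graph F a L \<longleftrightarrow>
     (\<forall>\<^sub>F x in nhds a. snd (L (x, F x)) = (\<Sum>i\<in>UNIV. partial_deriv i F x * fst (L (x, F x)) $ i))"

text \<open>
  Write \<open>\<theta> w = snd (A w) - (\<Sum>i. F\<^sub>i \<cdot> fst (A w) $ i)\<close> for the conormal composed with \<open>A\<close>. Differentiating
  the tangency relation in the direction \<open>j\<close> gives \<open>\<theta>(e\<^sub>j, F\<^sub>j) = (\<Sum>i. F\<^sub>i\<^sub>j Z\<^sub>i)\<close>, where \<open>Z\<close> is the
  horizontal part of the field. As the Hessian is an outer product, the right-hand sides for different \<open>j\<close>
  are proportional to \<open>F\<^sub>a\<^sub>j\<close>, which is the derivative of \<open>F\<^sub>j\<close> along the axis \<open>a\<close>. So the vector of the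
  \<open>\<theta>(e\<^sub>j, F\<^sub>j)\<close> is a multiple of the velocity of the conormal curve. By linearity it
  differs from the vector of the \<open>\<theta>(e\<^sub>j, 0)\<close> by \<open>\<theta>(0, 1)\<close> times that curve, and this is the factor \<open>\<kappa>\<close>.
  The identity is first stated without denominators, and the factor \<open>\<mu>\<close> is then obtained by dividing power series.
\<close>

lemma tangent_affine_field_moves_conormal_curve:
  fixes F :: "real^'n::finite \<Rightarrow> real" and A :: "(real^'n) \<times> real \<Rightarrow> (real^'n) \<times> real"
  assumes F: "real_analytic_at F 0"
    and outer: "\<forall>\<^sub>F x in nhds 0. \<exists>p q. \<forall>i j. hessian F x $ i $ j = p i * q j"
    and A: "linear A" and tangent: "tangent_to_graph F 0 (\<lambda>v. A v + b)"
    and \<Gamma>: "\<And>i. (\<lambda>x. partial_deriv i F (x *\<^sub>R axis a 1)) has_fps_expansion \<Gamma> i"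
    and \<Gamma>a: "fps_nth (\<Gamma> a) 1 \<noteq> 0"
  defines "\<kappa> \<equiv> fps_const (snd (A (0, 1))) - (\<Sum>i\<in>UNIV. fps_const (fst (A (0, 1)) $ i) * \<Gamma> i)"
  shows "\<exists>\<mu>. \<forall>j. (\<Sum>i\<in>UNIV. fps_const (fst (A (axis j 1, 0)) $ i) * \<Gamma> i) - fps_const (snd (A (axis j 1, 0)))
    = \<kappa> * \<Gamma> j + \<mu> * fps_deriv (\<Gamma> j)"
proof -
  have bl: "bounded_linear A"
    using A by (simp add: linear_conv_bounded_linear)
  let ?p = "\<lambda>i x. partial_deriv i F (x *\<^sub>R axis a 1)"
  \<comment> \<open>\<open>con w\<close> is \<open>\<theta> w\<close> along the axis, and \<open>\<nu> j\<close> is \<open>\<theta>(e\<^sub>j, F\<^sub>j)\<close>; \<open>acon\<close> and \<open>a\<nu>\<close> are their expansions.\<close>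
  define con where "con = (\<lambda>w x. snd (A w) - (\<Sum>i\<in>UNIV. fst (A w) $ i * ?p i x))"
  define acon where "acon = (\<lambda>w. fps_const (snd (A w)) - (\<Sum>i\<in>UNIV. fps_const (fst (A w) $ i) * \<Gamma> i))"
  have con_fps: "con w has_fps_expansion acon w" for w
    unfolding con_def acon_def by (intro fps_expansion_intros \<Gamma>)
  define \<nu> where "\<nu> = (\<lambda>j x. con (axis j 1, 0) x + ?p j x * con (0, 1) x)"
  define a\<nu> where "a\<nu> = (\<lambda>j. acon (axis j 1, 0) + \<Gamma> j * acon (0, 1))"
  have \<nu>_fps: "\<nu> j has_fps_expansion a\<nu> j" for j
    unfolding \<nu>_def a\<nu>_def by (intro fps_expansion_intros \<Gamma> con_fps)
  have "\<forall>\<^sub>F X in nhds (0::real^'n). \<forall>\<^sub>F x in nhds X. (F has_derivative (\<lambda>h. \<Sum>i\<in>UNIV. h $ i * partial_deriv i F x)) (at x)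
      \<and> snd (A (x, F x) + b) = (\<Sum>i\<in>UNIV. partial_deriv i F x * fst (A (x, F x) + b) $ i)"
    using real_analytic_at_has_derivative[OF F] tangent[unfolded tangent_to_graph_def]
    unfolding eventually_eventually by eventually_elim auto
  from eventually_compose_filterlim[OF this filterlim_axis[of a]]
    eventually_compose_filterlim[OF real_analytic_at_partial_deriv_has_derivative[OF F] filterlim_axis[of a]]
    eventually_compose_filterlim[OF real_analytic_at_hessian_symmetric[OF F] filterlim_axis[of a]]
    eventually_compose_filterlim[OF outer filterlim_axis[of a]]
  have pointwise: "\<forall>\<^sub>F x in nhds 0. deriv (?p a) x * deriv (?p a) x * \<nu> j x = deriv (?p a) x * deriv (?p j) x * \<nu> a x" for j
  proof eventually_elim
    case (elim x)
    let ?X = "x *\<^sub>R axis a 1 :: real^'n"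
    define H where "H = hessian F ?X"
    define Z where "Z = fst (A (?X, F ?X) + b)"
    define dF where "dF = (\<lambda>h. \<Sum>i\<in>UNIV. h $ i * partial_deriv i F ?X)"
    note near = eventually_nhds_x_imp_x[OF elim(1)]
    have dF: "(F has_derivative dF) (at ?X)"
      using near unfolding dF_def by blast
    have dL: "((\<lambda>x. A (x, F x) + b) has_derivative (\<lambda>h. A (h, dF h))) (at ?X)"
      using bounded_linear.has_derivative[OF bl has_derivative_Pair[OF has_derivative_ident dF]]
      by (auto intro!: derivative_eq_intros)
    have "((\<lambda>x. snd (A (x, F x) + b) - (\<Sum>i\<in>UNIV. partial_deriv i F x * fst (A (x, F x) + b) $ i)) has_derivative
        (\<lambda>h. snd (A (h, dF h)) - (\<Sum>i\<in>UNIV. partial_deriv i F ?X * fst (A (h, dF h)) $ i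
          + (\<Sum>l\<in>UNIV. h $ l * H $ i $ l) * Z $ i))) (at ?X)"
      unfolding Z_def H_def using elim(2)
      by (intro has_derivative_diff has_derivative_snd[OF dL] has_derivative_sum has_derivative_mult
          bounded_linear.has_derivative[OF bounded_linear_vec_nth has_derivative_fst[OF dL]]) auto
    moreover have "\<forall>\<^sub>F x in nhds ?X. snd (A (x, F x) + b) - (\<Sum>i\<in>UNIV. partial_deriv i F x * fst (A (x, F x) + b) $ i) = 0"
      using elim(1) by eventually_elim simp
    ultimately have E: "snd (A (h, dF h)) - (\<Sum>i\<in>UNIV. partial_deriv i F ?X * fst (A (h, dF h)) $ i
          + (\<Sum>l\<in>UNIV. h $ l * H $ i $ l) * Z $ i) = 0" for h
      by (rule derivative_zero_if_locally_zero)
    have first: "\<nu> j x = (\<Sum>i\<in>UNIV. H $ i $ j * Z $ i)" for j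
    proof -
      have "A (axis j 1, dF (axis j 1)) = A (axis j 1, 0) + partial_deriv j F ?X *\<^sub>R A (0, 1)"
        unfolding linear_scale[OF A, symmetric] linear_add[OF A, symmetric] by (simp add: dF_def sum_axis_mult)
      then show ?thesis
        using E[of "axis j 1"]
        by (simp add: \<nu>_def con_def sum_axis_mult sum.distrib algebra_simps sum_distrib_left)
    qed
    from elim(4) obtain p q where pq: "\<And>i j. H $ i $ j = p i * q j"
      unfolding H_def by blast
    have deriv_p: "deriv (?p i) x = H $ i $ a" for i
    proof -
      have "((\<lambda>y. y *\<^sub>R axis a 1) has_derivative (\<lambda>h. h *\<^sub>R axis a 1)) (at x)"
        by (auto intro!: derivative_eq_intros)
      from diff_chain_at[OF this, of "partial_deriv i F"] elim(2)
      have "(?p i has_derivative (\<lambda>h. \<Sum>l\<in>UNIV. (h *\<^sub>R axis a 1) $ l * H $ i $ l)) (at x)"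
        unfolding o_def H_def by blast
      moreover have "(\<lambda>h. \<Sum>l\<in>UNIV. (h *\<^sub>R axis a 1) $ l * H $ i $ l) = (*) (H $ i $ a)"
        using sum_axis_mult[of a "\<lambda>l. H $ i $ l"]
        by (auto simp: fun_eq_iff mult.assoc sum_distrib_left[symmetric])
      ultimately have "(?p i has_field_derivative H $ i $ a) (at x)"
        by (simp add: has_field_derivative_def)
      then show ?thesis
        by (rule DERIV_imp_deriv)
    qed
    have sym: "H $ j $ a = H $ a $ j"
      using elim(3) unfolding H_def by blast
    have "H $ a $ a * (\<Sum>i\<in>UNIV. H $ i $ j * Z $ i) = H $ a $ j * (\<Sum>i\<in>UNIV. H $ i $ a * Z $ i)"
      by (simp add: pq sum_distrib_left mult_ac)
    then show ?case
      unfolding deriv_p first sym by simp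
  qed
  have fps_eq: "fps_deriv (\<Gamma> a) * fps_deriv (\<Gamma> a) * a\<nu> j = fps_deriv (\<Gamma> a) * fps_deriv (\<Gamma> j) * a\<nu> a" for j
  proof -
    have "(\<lambda>x. deriv (?p a) x * deriv (?p a) x * \<nu> j x) has_fps_expansion fps_deriv (\<Gamma> a) * fps_deriv (\<Gamma> a) * a\<nu> j"
      "(\<lambda>x. deriv (?p a) x * deriv (?p j) x * \<nu> a x) has_fps_expansion fps_deriv (\<Gamma> a) * fps_deriv (\<Gamma> j) * a\<nu> a"
      by (intro fps_expansion_intros \<Gamma> \<nu>_fps)+
    then show ?thesis
      using pointwise by (rule has_fps_expansion_eqD)
  qed
  have unit: "fps_nth (fps_deriv (\<Gamma> a)) 0 \<noteq> 0"
    using \<Gamma>a by simp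
  then have nz: "fps_deriv (\<Gamma> a) \<noteq> 0"
    by (metis fps_zero_nth)
  define \<mu> where "\<mu> = - (inverse (fps_deriv (\<Gamma> a)) * a\<nu> a)"
  have "a\<nu> j = - \<mu> * fps_deriv (\<Gamma> j)" for j
  proof -
    have "fps_deriv (\<Gamma> a) * a\<nu> j = fps_deriv (\<Gamma> j) * a\<nu> a"
      using fps_eq[of j] nz by (simp add: mult.assoc)
    then have "inverse (fps_deriv (\<Gamma> a)) * fps_deriv (\<Gamma> a) * a\<nu> j
        = inverse (fps_deriv (\<Gamma> a)) * (fps_deriv (\<Gamma> j) * a\<nu> a)"
      by (simp add: mult.assoc)
    then show ?thesis
      unfolding inverse_mult_eq_1[OF unit] \<mu>_def by (simp add: mult_ac)
  qed
  then have "- acon (axis j 1, 0) = \<kappa> * \<Gamma> j + \<mu> * fps_deriv (\<Gamma> j)" for j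
    unfolding a\<nu>_def by (simp add: \<kappa>_def acon_def algebra_simps eq_neg_iff_add_eq_0)
  then show ?thesis
    unfolding acon_def by (intro exI[of _ \<mu>]) simp
qed

lemma affine_vector_field_zero: "affine_vector_field (\<lambda>_. 0)"
  unfolding affine_vector_field_def by (intro exI[of _ "\<lambda>_. 0"] exI[of _ 0]) (simp add: linear_zero)

lemma affine_vector_field_add:
  assumes "affine_vector_field L" "affine_vector_field L'"
  shows "affine_vector_field (\<lambda>v. L v + L' v)"
proof -
  obtain A b A' b' where "linear A" "L = (\<lambda>p. A p + b)" "linear A'" "L' = (\<lambda>p. A' p + b')"
    using assms unfolding affine_vector_field_def by blast
  then show ?thesis
    unfolding affine_vector_field_def
    by (intro exI[of _ "\<lambda>p. A p + A' p"] exI[of _ "b + b'"]) (auto intro: linear_compose_add)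
qed

lemma affine_vector_field_scaleR:
  assumes "affine_vector_field L"
  shows "affine_vector_field (\<lambda>v. r *\<^sub>R L v)"
proof -
  obtain A b where "linear A" "L = (\<lambda>p. A p + b)"
    using assms unfolding affine_vector_field_def by blast
  then show ?thesis
    unfolding affine_vector_field_def
    by (intro exI[of _ "\<lambda>p. r *\<^sub>R A p"] exI[of _ "r *\<^sub>R b"]) (auto intro: linear_compose_scale_right simp: scaleR_add_right)
qed

lemma tangent_to_graph_zero: "tangent_to_graph F a (\<lambda>_. 0)"
  by (simp add: tangent_to_graph_def)

lemma tangent_to_graph_add:
  assumes "tangent_to_graph F a L" "tangent_to_graph F a L'"
  shows "tangent_to_graph F a (\<lambda>v. L v + L' v)"
  using assms unfolding tangent_to_graph_def
  by eventually_elim (simp add: sum.distrib distrib_left)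

lemma tangent_to_graph_scaleR:
  assumes "tangent_to_graph F a L"
  shows "tangent_to_graph F a (\<lambda>v. r *\<^sub>R L v)"
  using assms unfolding tangent_to_graph_def
  by eventually_elim (simp add: sum_distrib_left mult_ac)

lemma tangent_to_graph_sum:
  assumes "finite I" "\<And>i. i \<in> I \<Longrightarrow> tangent_to_graph F a (L i)"
  shows "tangent_to_graph F a (\<lambda>v. \<Sum>i\<in>I. L i v)"
  using assms by (induction I rule: finite_induct) (auto intro: tangent_to_graph_zero tangent_to_graph_add)


section \<open>From the hypersurface to its graph\<close>

lemma linear_inv_if_bij:
  assumes "linear M" "bij M"
  shows "linear (inv M)"
proof (rule linearI)
  note right = surj_f_inv_f[OF bij_is_surj[OF assms(2)]]
  show "inv M (x + y) = inv M x + inv M y" for x y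
    by (rule inv_f_eq[OF bij_is_inj[OF assms(2)]]) (simp add: linear_add[OF assms(1)] right)
  show "inv M (r *\<^sub>R x) = r *\<^sub>R inv M x" for r x
    by (rule inv_f_eq[OF bij_is_inj[OF assms(2)]]) (simp add: linear_scale[OF assms(1)] right)
qed

lemma isCont_imp_filterlim_nhds:
  "isCont g x \<Longrightarrow> g x = y \<Longrightarrow> filterlim g (nhds y) (nhds x)"
  by (auto simp: isCont_def tendsto_at_iff_tendsto_nhds)

text \<open>
  Every statement about points of \<open>H\<close> near \<open>p0\<close> is turned into one about points \<open>x\<close> near the base point of
  the graph by composing with \<open>\<gamma>\<close>.
\<close>

lemma graph_parametrization:
  fixes \<phi> :: "(real^'n::finite) \<times> real \<Rightarrow> (real^'n) \<times> real"
  assumes graph: "is_graph_at \<phi> F H p0" and \<phi>: "linear M" "bij M" "\<phi> = (\<lambda>p. M p + d)"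
  defines "\<gamma> \<equiv> \<lambda>x. inv M ((x, F x) - d)"
  shows "\<phi> (\<gamma> x) = (x, F x)" "\<gamma> (fst (\<phi> p0)) = p0"
    "filterlim \<gamma> (nhds p0) (nhds (fst (\<phi> p0)))" "\<forall>\<^sub>F x in nhds (fst (\<phi> p0)). \<gamma> x \<in> H"
proof -
  let ?a = "fst (\<phi> p0)"
  obtain U where U: "open U" "p0 \<in> U" "\<And>p. p \<in> U \<Longrightarrow> p \<in> H \<longleftrightarrow> snd (\<phi> p) = F (fst (\<phi> p))"
    and "p0 \<in> H" and F: "real_analytic_at F ?a"
    using graph unfolding is_graph_at_def by blast
  show \<phi>\<gamma>: "\<phi> (\<gamma> x) = (x, F x)" for x
    unfolding \<phi>(3) \<gamma>_def using surj_f_inv_f[OF bij_is_surj[OF \<phi>(2)]] by simp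
  have "\<phi> p0 = (?a, F ?a)"
    using U \<open>p0 \<in> H\<close> by (metis prod.collapse)
  then have "(?a, F ?a) - d = M p0"
    using fun_cong[OF \<phi>(3), of p0] by (simp only: add_diff_cancel_right')
  then show \<gamma>a: "\<gamma> ?a = p0"
    unfolding \<gamma>_def by (simp only: inv_f_f[OF bij_is_inj[OF \<phi>(2)]])
  have "isCont F ?a"
    using eventually_nhds_x_imp_x[OF real_analytic_at_has_derivative[OF F]] has_derivative_continuous by blast
  then have "isCont (\<lambda>x. (x, F x) - d) ?a"
    by (intro continuous_intros)
  moreover have "bounded_linear (inv M)"
    using linear_inv_if_bij[OF \<phi>(1,2)] by (simp add: linear_conv_bounded_linear)
  ultimately have "isCont \<gamma> ?a"
    unfolding \<gamma>_def using bounded_linear.isCont by blast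
  then show lim: "filterlim \<gamma> (nhds p0) (nhds ?a)"
    using \<gamma>a by (rule isCont_imp_filterlim_nhds)
  have "\<forall>\<^sub>F p in nhds p0. p \<in> U"
    using U(1,2) by (rule eventually_nhds_in_open)
  from eventually_compose_filterlim[OF this lim] show "\<forall>\<^sub>F x in nhds ?a. \<gamma> x \<in> H"
    by eventually_elim (simp add: U(3) \<phi>\<gamma>)
qed

text \<open>
  The two graph coordinate systems differ by the affine map \<open>\<phi>' \<circ> \<phi>\<^sup>-\<^sup>1\<close>, to which
  \<open>hessian_outer_product_transfer\<close> applies.
\<close>

lemma constant_hessian_rank_one_imp_outer_product:
  fixes \<phi> :: "(real^'n::finite) \<times> real \<Rightarrow> (real^'n) \<times> real"
  assumes graph: "is_graph_at \<phi> F H p0" and "constant_hessian_rank_one H p0"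
  shows "\<forall>\<^sub>F x in nhds (fst (\<phi> p0)). \<exists>p q. \<forall>i j. hessian F x $ i $ j = p i * q j"
proof -
  obtain \<phi>' F' where graph': "is_graph_at \<phi>' F' H p0"
    and rank: "\<forall>\<^sub>F x in nhds (fst (\<phi>' p0)). rank (hessian F' x) = 1"
    using assms(2) unfolding constant_hessian_rank_one_def by blast
  obtain M d where \<phi>: "linear M" "bij M" "\<phi> = (\<lambda>p. M p + d)"
    using graph unfolding is_graph_at_def affine_iso_def by blast
  obtain M' d' where \<phi>': "linear M'" "bij M'" "\<phi>' = (\<lambda>p. M' p + d')"
    using graph' unfolding is_graph_at_def affine_iso_def by blast
  obtain U where U: "open U" "p0 \<in> U" "\<And>p. p \<in> U \<Longrightarrow> p \<in> H \<longleftrightarrow> snd (\<phi>' p) = F' (fst (\<phi>' p))"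
    using graph' unfolding is_graph_at_def by blast
  note \<gamma> = graph_parametrization[OF graph \<phi>]
  let ?a = "fst (\<phi> p0)"
  let ?K = "M' \<circ> inv M"
  let ?k = "d' - M' (inv M d)"
  have lin_inv: "linear (inv M)"
    using \<phi>(1,2) by (simp add: linear_inv_if_bij)
  have change: "\<phi>' (inv M ((x, F x) - d)) = ?K (x, F x) + ?k" for x
    unfolding \<phi>'(3) by (simp add: linear_diff[OF lin_inv] linear_diff[OF \<phi>'(1)])
  have base: "fst (?K (?a, F ?a) + ?k) = fst (\<phi>' p0)"
    using change[of ?a] \<gamma>(2) by simp
  show ?thesis
  proof (rule hessian_outer_product_transfer)
    show "linear ?K"
      using lin_inv \<phi>'(1) by (rule linear_compose)
    show "surj ?K"
      by (intro bij_is_surj bij_comp bij_imp_bij_inv \<phi>(2) \<phi>'(2))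
    show "real_analytic_at F ?a"
      using graph unfolding is_graph_at_def by blast
    show "real_analytic_at F' (fst (?K (?a, F ?a) + ?k))"
      using graph' unfolding is_graph_at_def base by blast
    have "\<forall>\<^sub>F p in nhds p0. p \<in> U"
      using U(1,2) by (rule eventually_nhds_in_open)
    from eventually_compose_filterlim[OF this \<gamma>(3)] \<gamma>(4)
    show "\<forall>\<^sub>F x in nhds ?a. snd (?K (x, F x) + ?k) = F' (fst (?K (x, F x) + ?k))"
      unfolding change[symmetric] by eventually_elim (simp add: U(3))
    show "\<forall>\<^sub>F y in nhds (fst (?K (?a, F ?a) + ?k)). \<exists>p q. \<forall>i j. hessian F' y $ i $ j = p i * q j"
      unfolding base using rank by eventually_elim (rule rank_eq_1_imp_outer_product)
  qed
qed

lemma tangent_space_graph: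
  fixes M :: "'a::euclidean_space \<Rightarrow> (real^'n::finite) \<times> real"
  assumes v: "v \<in> tangent_space H q" and M: "linear M"
    and U: "open U" "q \<in> U" "\<And>p. p \<in> U \<Longrightarrow> p \<in> H \<Longrightarrow> snd (M p + d) = F (fst (M p + d))"
    and F: "(F has_derivative F') (at (fst (M q + d)))"
  shows "snd (M v) = F' (fst (M v))"
proof -
  obtain \<gamma> where \<gamma>: "\<gamma> 0 = q" "\<forall>\<^sub>F t in nhds 0. \<gamma> t \<in> H" "(\<gamma> has_vector_derivative v) (at 0)"
    using v unfolding tangent_space_def by blast
  have bl: "bounded_linear M"
    using M by (simp add: linear_conv_bounded_linear)
  have "((\<lambda>t. M (\<gamma> t) + d) has_derivative (\<lambda>t. M (t *\<^sub>R v) + 0)) (at 0)"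
    using \<gamma>(3) unfolding has_vector_derivative_def
    by (intro has_derivative_add bounded_linear.has_derivative[OF bl] has_derivative_const)
  then have d: "((\<lambda>t. M (\<gamma> t) + d) has_derivative (\<lambda>t. M (t *\<^sub>R v))) (at 0)"
    by simp
  have "((\<lambda>t. F (fst (M (\<gamma> t) + d))) has_derivative (\<lambda>t. F' (fst (M (t *\<^sub>R v))))) (at 0)"
    using diff_chain_at[OF has_derivative_fst[OF d], of F F'] F \<gamma>(1) by (simp add: o_def)
  with has_derivative_snd[OF d]
  have "((\<lambda>t. snd (M (\<gamma> t) + d) - F (fst (M (\<gamma> t) + d))) has_derivative
      (\<lambda>t. snd (M (t *\<^sub>R v)) - F' (fst (M (t *\<^sub>R v))))) (at 0)"
    by (rule has_derivative_diff)
  moreover have "\<forall>\<^sub>F t in nhds 0. snd (M (\<gamma> t) + d) - F (fst (M (\<gamma> t) + d)) = 0"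
  proof -
    have "isCont \<gamma> 0"
      using \<gamma>(3) has_vector_derivative_continuous by blast
    then have "filterlim \<gamma> (nhds q) (nhds 0)"
      using \<gamma>(1) by (rule isCont_imp_filterlim_nhds)
    from eventually_compose_filterlim[OF eventually_nhds_in_open[OF U(1,2)] this] \<gamma>(2)
    show ?thesis
      by eventually_elim (simp add: U(3) del: fst_add snd_add)
  qed
  ultimately have "snd (M (1 *\<^sub>R v)) - F' (fst (M (1 *\<^sub>R v))) = 0"
    by (rule derivative_zero_if_locally_zero)
  then show ?thesis
    by simp
qed

lemma affine_sym_tangent_to_graph:
  fixes \<phi> :: "(real^'n::finite) \<times> real \<Rightarrow> (real^'n) \<times> real"
  assumes graph: "is_graph_at \<phi> F H p0" and \<phi>: "linear M" "bij M" "\<phi> = (\<lambda>p. M p + d)"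
    and L: "L \<in> affine_sym H p0"
  shows "affine_vector_field (\<lambda>y. M (L (inv M (y - d))))"
    and "tangent_to_graph F (fst (\<phi> p0)) (\<lambda>y. M (L (inv M (y - d))))"
proof -
  obtain A b V where A: "linear A" "L = (\<lambda>p. A p + b)"
    and V: "open V" "p0 \<in> V" "\<And>q. q \<in> H \<inter> V \<Longrightarrow> L q \<in> tangent_space H q"
    using L unfolding affine_sym_def affine_vector_field_def by auto
  obtain U where U: "open U" "p0 \<in> U" "\<And>p. p \<in> U \<Longrightarrow> p \<in> H \<longleftrightarrow> snd (\<phi> p) = F (fst (\<phi> p))"
    and F: "real_analytic_at F (fst (\<phi> p0))"
    using graph unfolding is_graph_at_def by blast
  have lin_inv: "linear (inv M)"
    using \<phi>(1,2) by (simp add: linear_inv_if_bij)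
  have "(\<lambda>y. M (L (inv M (y - d)))) = (\<lambda>y. (M \<circ> (A \<circ> inv M)) y + M (b - A (inv M d)))"
    by (simp add: A(2) fun_eq_iff linear_diff[OF lin_inv] linear_diff[OF A(1)] linear_add[OF \<phi>(1)] linear_diff[OF \<phi>(1)])
  moreover have "linear (M \<circ> (A \<circ> inv M))"
    by (intro linear_compose lin_inv A(1) \<phi>(1))
  ultimately show "affine_vector_field (\<lambda>y. M (L (inv M (y - d))))"
    unfolding affine_vector_field_def by blast
  note \<gamma> = graph_parametrization[OF graph \<phi>]
  have "\<forall>\<^sub>F p in nhds p0. p \<in> U \<inter> V"
    using U(1,2) V(1,2) by (intro eventually_nhds_in_open) auto
  from eventually_compose_filterlim[OF this \<gamma>(3)] \<gamma>(4) real_analytic_at_has_derivative[OF F]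
  show "tangent_to_graph F (fst (\<phi> p0)) (\<lambda>y. M (L (inv M (y - d))))"
    unfolding tangent_to_graph_def
  proof eventually_elim
    case (elim x)
    let ?q = "inv M ((x, F x) - d)"
    have "snd (M (L ?q)) = (\<Sum>i\<in>UNIV. fst (M (L ?q)) $ i * partial_deriv i F x)"
    proof (rule tangent_space_graph[OF _ \<phi>(1) U(1)])
      show "L ?q \<in> tangent_space H ?q" "?q \<in> U"
        using elim V(3) by auto
      show "snd (M p + d) = F (fst (M p + d))" if "p \<in> U" "p \<in> H" for p
        using U(3)[OF that(1)] that(2) by (simp add: \<phi>(3))
      show "(F has_derivative (\<lambda>h. \<Sum>i\<in>UNIV. h $ i * partial_deriv i F x)) (at (fst (M ?q + d)))"
        using elim(3) \<gamma>(1)[of x] by (simp add: \<phi>(3))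
    qed
    then show ?case
      by (simp add: mult.commute)
  qed
qed

text \<open>
  The lift of the \<open>i\<close>-th coordinate line to \<open>H\<close> is a curve through \<open>p0\<close>, so its velocity lies in the span of
  the values of symmetries at \<open>p0\<close>. Such values, transported by \<open>\<phi>\<close>, are attained by affine fields tangent
  to the graph, and the set of all values attained by these is a subspace.
\<close>

lemma affinely_homogeneous_imp_transitive:
  fixes \<phi> :: "(real^'n::finite) \<times> real \<Rightarrow> (real^'n) \<times> real"
  assumes graph: "is_graph_at \<phi> F H p0" and hom: "affinely_homogeneous H p0"
  shows "\<exists>L. affine_vector_field L \<and> tangent_to_graph F (fst (\<phi> p0)) L \<and> fst (L (\<phi> p0)) = axis i 1"
proof -
  obtain M d where \<phi>: "linear M" "bij M" "\<phi> = (\<lambda>p. M p + d)"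
    using graph unfolding is_graph_at_def affine_iso_def by blast
  let ?a = "fst (\<phi> p0)"
  note \<gamma> = graph_parametrization[OF graph \<phi>]
  have F: "real_analytic_at F ?a"
    using graph unfolding is_graph_at_def by blast
  have lin_inv: "linear (inv M)"
    using \<phi>(1,2) by (simp add: linear_inv_if_bij)
  have M_inv: "M (inv M y) = y" for y
    using surj_f_inv_f[OF bij_is_surj[OF \<phi>(2)]] .
  let ?v = "inv M (axis i 1, partial_deriv i F ?a)"
  have "?v \<in> tangent_space H p0"
    unfolding tangent_space_def
  proof (intro CollectI exI conjI)
    let ?c = "\<lambda>t. inv M ((?a + t *\<^sub>R axis i 1, F (?a + t *\<^sub>R axis i 1)) - d)"
    show "?c 0 = p0"
      using \<gamma>(2) by simp
    have "((\<lambda>t. ?a + t *\<^sub>R axis i 1) \<longlongrightarrow> ?a + 0 *\<^sub>R axis i 1) (nhds (0::real))"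
      by (intro tendsto_add tendsto_scaleR tendsto_const filterlim_ident)
    then have "filterlim (\<lambda>t. ?a + t *\<^sub>R axis i 1) (nhds ?a) (nhds (0::real))"
      by simp
    from eventually_compose_filterlim[OF \<gamma>(4) this] show "\<forall>\<^sub>F t in nhds 0. ?c t \<in> H" .
    have "((\<lambda>t. F (?a + t *\<^sub>R axis i 1)) has_vector_derivative partial_deriv i F ?a) (at 0)"
      using has_derivative_imp_line_derivative[OF eventually_nhds_x_imp_x[OF real_analytic_at_has_derivative[OF F]], of "axis i 1"]
      by (simp add: sum_axis_mult has_real_derivative_iff_has_vector_derivative)
    moreover have "((\<lambda>t. ?a + t *\<^sub>R axis i 1) has_vector_derivative axis i 1) (at 0)"
      by (auto intro!: derivative_eq_intros)
    ultimately have "((\<lambda>t. (?a + t *\<^sub>R axis i 1, F (?a + t *\<^sub>R axis i 1)) - d) has_vector_derivative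
        (axis i 1, partial_deriv i F ?a) - 0) (at 0)"
      by (intro has_vector_derivative_diff has_vector_derivative_Pair has_vector_derivative_const)
    from bounded_linear.has_vector_derivative[OF _ this, of "inv M"]
    show "(?c has_vector_derivative ?v) (at 0)"
      using lin_inv by (simp add: linear_conv_bounded_linear)
  qed
  also have "tangent_space H p0 = span {L p0 |L. L \<in> affine_sym H p0}"
    using hom unfolding affinely_homogeneous_def .
  also have "\<dots> \<subseteq> {w. \<exists>L. affine_vector_field L \<and> tangent_to_graph F ?a L \<and> L (\<phi> p0) = M w}"
  proof (rule span_minimal)
    have p0: "inv M (\<phi> p0 - d) = p0"
      using inv_f_f[OF bij_is_inj[OF \<phi>(2)]] by (simp add: \<phi>(3))
    show "{L p0 |L. L \<in> affine_sym H p0} \<subseteq> {w. \<exists>L. affine_vector_field L \<and> tangent_to_graph F ?a L \<and> L (\<phi> p0) = M w}"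
    proof (intro subsetI CollectI)
      fix w assume "w \<in> {L p0 |L. L \<in> affine_sym H p0}"
      then obtain L where "w = L p0" "L \<in> affine_sym H p0"
        by blast
      with affine_sym_tangent_to_graph[OF graph \<phi> this(2)]
      show "\<exists>L'. affine_vector_field L' \<and> tangent_to_graph F ?a L' \<and> L' (\<phi> p0) = M w"
        by (intro exI[of _ "\<lambda>y. M (L (inv M (y - d)))"]) (simp add: p0)
    qed
    show "subspace {w. \<exists>L. affine_vector_field L \<and> tangent_to_graph F ?a L \<and> L (\<phi> p0) = M w}"
      (is "subspace ?W")
    proof (rule subspaceI)
      show "0 \<in> ?W"
        using affine_vector_field_zero tangent_to_graph_zero linear_0[OF \<phi>(1)] by force
      show "v + w \<in> ?W" if "v \<in> ?W" "w \<in> ?W" for v w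
      proof -
        from that obtain L L' where "affine_vector_field L" "tangent_to_graph F ?a L" "L (\<phi> p0) = M v"
          "affine_vector_field L'" "tangent_to_graph F ?a L'" "L' (\<phi> p0) = M w"
          by blast
        then show ?thesis
          by (intro CollectI exI[of _ "\<lambda>y. L y + L' y"])
            (simp add: affine_vector_field_add tangent_to_graph_add linear_add[OF \<phi>(1)])
      qed
      show "r *\<^sub>R v \<in> ?W" if "v \<in> ?W" for r v
      proof -
        from that obtain L where "affine_vector_field L" "tangent_to_graph F ?a L" "L (\<phi> p0) = M v"
          by blast
        then show ?thesis
          by (intro CollectI exI[of _ "\<lambda>y. r *\<^sub>R L y"])
            (simp add: affine_vector_field_scaleR tangent_to_graph_scaleR linear_scale[OF \<phi>(1)])
      qed
    qed
  qed
  finally obtain L where "affine_vector_field L" "tangent_to_graph F ?a L" "L (\<phi> p0) = M ?v"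
    by blast
  then show ?thesis
    by (intro exI[of _ L]) (simp add: M_inv)
qed


section \<open>The dimension count\<close>

lemma linear_not_inj_if_DIM_less:
  fixes T :: "'a::euclidean_space \<Rightarrow> 'b::euclidean_space"
  assumes "linear T" "DIM('b) < DIM('a)"
  obtains c where "c \<noteq> 0" "T c = 0"
proof -
  have "\<not> inj T"
  proof
    assume "inj T"
    then have "dim (range T) = DIM('a)"
      using dim_image_eq[OF assms(1), of UNIV] by simp
    with assms(2) show False
      using dim_subset_UNIV[of "range T"] by simp
  qed
  then show thesis
    using that assms(1) by (auto simp: linear_injective_0)
qed

text \<open>
  The transpose of \<open>A\<close> acts on conormals \<open>(1, -F\<^sub>1, \<dots>, -F\<^sub>n)\<close>. Conjugating it by the diagonal matrix
  \<open>(1, -1, \<dots>, -1)\<close> gives an action on the curve \<open>(1, F\<^sub>1, \<dots>, F\<^sub>n)\<close>. The index \<open>0\<close> stands for the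
  coordinate \<open>u\<close>, and \<open>k \<ge> 1\<close> for the coordinate \<open>e k\<close>.
\<close>

definition conormal_matrix ::
    "(nat \<Rightarrow> 'n::finite) \<Rightarrow> ((real^'n) \<times> real \<Rightarrow> (real^'n) \<times> real) \<Rightarrow> nat \<Rightarrow> nat \<Rightarrow> real" where
  "conormal_matrix e A j k =
     (if j = 0 then (if k = 0 then snd (A (0, 1)) else - (fst (A (0, 1)) $ e k))
      else (if k = 0 then - snd (A (axis (e j) 1, 0)) else fst (A (axis (e j) 1, 0)) $ e k))"

text \<open>
  Take fields \<open>A\<^sub>i p + b\<^sub>i\<close> with value \<open>e\<^sub>i\<close> (up to the last component) at the origin. Four linear conditions
  on \<open>n \<ge> 5\<close> unknowns leave a nontrivial combination \<open>c\<close> for which \<open>\<lambda>(0) = \<mu>(0) = \<mu>'(0) = \<mu>''(0) = 0\<close>.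
  Its linear part is zero; its constant part is annihilated by the conormal curve and is zero too. But the
  horizontal component of the constant part is \<open>c\<close> itself.
\<close>

lemma no_transitive_affine_symmetry:
  fixes F :: "real^'n::finite \<Rightarrow> real"
  assumes n: "5 \<le> CARD('n)" and e: "bij_betw e {1..CARD('n)} (UNIV :: 'n set)"
    and R: "R \<in> big_O_vars (e ` {2..CARD('n)}) 3" and S: "S \<in> big_O_vars UNIV (CARD('n) + 2)"
    and nf: "\<forall>\<^sub>F x in nhds 0. F x = normal_form_part e x + R x + S x"
    and F: "real_analytic_at F 0"
    and outer: "\<forall>\<^sub>F x in nhds 0. \<exists>p q. \<forall>i j. hessian F x $ i $ j = p i * q j"
    and transitive: "\<And>i. \<exists>L. affine_vector_field L \<and> tangent_to_graph F 0 L \<and> fst (L 0) = axis i 1"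
  shows False
proof -
  let ?n = "CARD('n)"
  have n2: "2 \<le> ?n"
    using n by simp
  define idx where "idx = inv_into {1..?n} e"
  have idx: "e (idx i) = i" "1 \<le> idx i" "idx i \<le> ?n" for i
    using bij_betw_inv_into_right[OF e, of i] bij_betw_apply[OF bij_betw_inv_into[OF e], of i]
    by (auto simp: idx_def)
  have idx0: "idx i \<noteq> 0" for i
    using idx(2)[of i] by simp
  have idx_e: "idx (e k) = k" if "1 \<le> k" "k \<le> ?n" for k
    using bij_betw_inv_into_left[OF e, of k] that by (simp add: idx_def)
  obtain \<Gamma> where \<Gamma>: "\<And>i. (\<lambda>x. partial_deriv i F (x *\<^sub>R axis (e 1) 1)) has_fps_expansion \<Gamma> i"
    and \<Gamma>_nth: "\<And>i k. k \<le> ?n \<Longrightarrow> fps_nth (\<Gamma> i) k = (if k = idx i then 1 / fact k else 0)"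
    using nondegenerate_gradient_on_axis[OF e n2 R S nf idx(2,3)] unfolding idx(1) by metis
  define G where "G = (\<lambda>j. if j = 0 then 1 else \<Gamma> (e j))"
  have G_nth: "fps_nth (G j) k = (if j = k then 1 / fact k else 0)" if "j \<le> ?n" "k \<le> ?n" for j k
    using that idx_e[of j] by (auto simp: G_def \<Gamma>_nth)
  have sum_G: "(\<Sum>k\<le>?n. fps_const (P k) * G k) = fps_const (P 0) + (\<Sum>i\<in>UNIV. fps_const (P (idx i)) * \<Gamma> i)" for P
  proof -
    have "{..?n} = insert 0 {1..?n}"
      by auto
    then have "(\<Sum>k\<le>?n. fps_const (P k) * G k) = fps_const (P 0) + (\<Sum>k\<in>{1..?n}. fps_const (P k) * G k)"
      by (simp add: G_def)
    also have "(\<Sum>k\<in>{1..?n}. fps_const (P k) * G k) = (\<Sum>k\<in>{1..?n}. fps_const (P (idx (e k))) * \<Gamma> (e k))"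
      by (rule sum.cong) (auto simp: G_def idx_e)
    also have "(\<Sum>k\<in>{1..?n}. fps_const (P (idx (e k))) * \<Gamma> (e k)) = (\<Sum>i\<in>UNIV. fps_const (P (idx i)) * \<Gamma> i)"
      by (rule sum.reindex_bij_betw[OF e])
    finally show ?thesis .
  qed
  have "\<exists>A b. linear A \<and> tangent_to_graph F 0 (\<lambda>v. A v + b) \<and> fst b = axis i 1" for i
  proof -
    obtain L A b where L: "tangent_to_graph F 0 L" "fst (L 0) = axis i 1" "linear A" "L = (\<lambda>p. A p + b)"
      using transitive[of i] unfolding affine_vector_field_def by blast
    then have "fst b = axis i 1"
      by (simp add: linear_0)
    with L show ?thesis
      by blast
  qed
  then obtain A b where A: "\<And>i. linear (A i)" and tangent: "\<And>i. tangent_to_graph F 0 (\<lambda>v. A i v + b i)"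
    and b: "\<And>i. fst (b i) = axis i 1"
    by metis
  have "\<exists>l m. \<forall>j\<le>?n. (\<Sum>k\<le>?n. fps_const (conormal_matrix e (A i) j k) * G k) = l * G j + m * fps_deriv (G j)" for i
  proof -
    have "fps_nth (\<Gamma> (e 1)) 1 \<noteq> 0"
      using \<Gamma>_nth[of 1 "e 1"] idx_e[of 1] n by simp
    from tangent_affine_field_moves_conormal_curve[OF F outer A tangent \<Gamma> this]
    obtain m where m: "\<And>j. (\<Sum>i'\<in>UNIV. fps_const (fst (A i (axis j 1, 0)) $ i') * \<Gamma> i') - fps_const (snd (A i (axis j 1, 0)))
        = (fps_const (snd (A i (0, 1))) - (\<Sum>i'\<in>UNIV. fps_const (fst (A i (0, 1)) $ i') * \<Gamma> i')) * \<Gamma> j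
          + m * fps_deriv (\<Gamma> j)"
      by blast
    let ?l = "fps_const (snd (A i (0, 1))) - (\<Sum>i'\<in>UNIV. fps_const (fst (A i (0, 1)) $ i') * \<Gamma> i')"
    have "(\<Sum>k\<le>?n. fps_const (conormal_matrix e (A i) j k) * G k) = ?l * G j + m * fps_deriv (G j)" for j
    proof (cases "j = 0")
      case True
      then show ?thesis
        unfolding sum_G
        by (simp add: conormal_matrix_def idx idx0 G_def sum_negf fps_const_neg[symmetric] del: fps_const_neg)
    next
      case False
      then show ?thesis
        unfolding sum_G using m[of "e j"]
        by (simp add: conormal_matrix_def idx idx0 G_def fps_const_neg[symmetric] del: fps_const_neg)
    qed
    then show ?thesis
      by blast
  qed
  then obtain l m where lm: "\<And>i j. j \<le> ?n \<Longrightarrow>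
      (\<Sum>k\<le>?n. fps_const (conormal_matrix e (A i) j k) * G k) = l i * G j + m i * fps_deriv (G j)"
    by metis
  \<comment> \<open>The factor \<open>1/2\<close> between \<open>\<mu>''(0)\<close> and the coefficient of \<open>x\<^sup>2\<close> does not affect the kernel.\<close>
  define T :: "real^'n \<Rightarrow> real \<times> real \<times> real \<times> real" where
    "T = (\<lambda>c. (\<Sum>i\<in>UNIV. c $ i * fps_nth (l i) 0, \<Sum>i\<in>UNIV. c $ i * fps_nth (m i) 0,
           \<Sum>i\<in>UNIV. c $ i * fps_nth (m i) 1, \<Sum>i\<in>UNIV. c $ i * fps_nth (m i) 2))"
  have "linear T"
    unfolding T_def by (rule linearI) (simp_all add: sum.distrib sum_distrib_left algebra_simps)
  then obtain c where "c \<noteq> 0" "T c = 0"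
    using linear_not_inj_if_DIM_less[of T] n by auto
  define l' where "l' = (\<Sum>i\<in>UNIV. fps_const (c $ i) * l i)"
  define m' where "m' = (\<Sum>i\<in>UNIV. fps_const (c $ i) * m i)"
  have jets: "fps_nth l' 0 = 0" "fps_nth m' 0 = 0" "fps_nth m' 1 = 0" "fps_nth m' 2 = 0"
    using \<open>T c = 0\<close> by (simp_all add: T_def l'_def m'_def fps_sum_nth zero_prod_def)
  define A' where "A' = (\<lambda>v. \<Sum>i\<in>UNIV. c $ i *\<^sub>R A i v)"
  define b' where "b' = (\<Sum>i\<in>UNIV. c $ i *\<^sub>R b i)"
  have "linear A'"
    unfolding A'_def using A by (intro linear_compose_sum ballI linear_compose_scale_right)
  have matrix: "conormal_matrix e A' j k = (\<Sum>i\<in>UNIV. c $ i * conormal_matrix e (A i) j k)" for j k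
    by (simp add: conormal_matrix_def A'_def fst_sum snd_sum sum_negf)
  have "(\<Sum>k\<le>?n. fps_const (conormal_matrix e A' j k) * G k) = l' * G j + m' * fps_deriv (G j)" if "j \<le> ?n" for j
  proof -
    have "fps_const (conormal_matrix e A' j k) = (\<Sum>i\<in>UNIV. fps_const (c $ i) * fps_const (conormal_matrix e (A i) j k))" for k
      by (rule fps_ext) (simp add: matrix fps_sum_nth)
    then have "(\<Sum>k\<le>?n. fps_const (conormal_matrix e A' j k) * G k)
        = (\<Sum>k\<le>?n. \<Sum>i\<in>UNIV. fps_const (c $ i) * (fps_const (conormal_matrix e (A i) j k) * G k))"
      by (simp add: sum_distrib_right mult.assoc del: fps_const_mult)
    also have "\<dots> = (\<Sum>i\<in>UNIV. fps_const (c $ i) * (\<Sum>k\<le>?n. fps_const (conormal_matrix e (A i) j k) * G k))"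
      by (subst sum.swap) (simp add: sum_distrib_left)
    also have "\<dots> = l' * G j + m' * fps_deriv (G j)"
      by (simp add: lm[OF that] l'_def m'_def sum.distrib distrib_left sum_distrib_right mult.assoc)
    finally show ?thesis .
  qed
  from osculating_curve_symmetry_trivial[OF n2 G_nth this jets]
  have P0: "conormal_matrix e A' j k = 0" if "j \<le> ?n" "k \<le> ?n" for j k
    using that by blast
  have "snd (A' (0, 1)) = 0" "fst (A' (0, 1)) $ i = 0" for i
    using P0[of 0 0] P0[of 0 "idx i"] idx0[of i] idx[of i] by (simp_all add: conormal_matrix_def)
  then have "A' (0, 1) = 0"
    by (simp add: prod_eq_iff vec_eq_iff)
  moreover have "A' (axis i 1, 0) = 0" for i
  proof -
    have "snd (A' (axis i 1, 0)) = 0" "fst (A' (axis i 1, 0)) $ k = 0" for k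
      using P0[of "idx i" 0] P0[of "idx i" "idx k"] idx0 idx by (simp_all add: conormal_matrix_def)
    then show ?thesis
      by (simp add: prod_eq_iff vec_eq_iff)
  qed
  ultimately have "A' = (\<lambda>_. 0)"
    using \<open>linear A'\<close> by (intro linear_eq_stdbasis) (auto simp: linear_zero Basis_prod_def Basis_vec_def)
  have "tangent_to_graph F 0 (\<lambda>v. \<Sum>i\<in>UNIV. c $ i *\<^sub>R (A i v + b i))"
    by (intro tangent_to_graph_sum tangent_to_graph_scaleR tangent) simp
  moreover have "(\<Sum>i\<in>UNIV. c $ i *\<^sub>R (A i v + b i)) = b'" for v
    using fun_cong[OF \<open>A' = (\<lambda>_. 0)\<close>, of v]
    by (simp add: b'_def A'_def scaleR_add_right sum.distrib)
  ultimately have "\<forall>\<^sub>F x in nhds 0. snd b' = (\<Sum>i\<in>UNIV. partial_deriv i F x * fst b' $ i)"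
    by (simp add: tangent_to_graph_def)
  from eventually_compose_filterlim[OF this filterlim_axis[of "e 1"]]
  have "fps_const (snd b') = (\<Sum>i\<in>UNIV. \<Gamma> i * fps_const (fst b' $ i))"
    by (rule has_fps_expansion_eqD[rotated 2]) (intro fps_expansion_intros \<Gamma>)+
  moreover have "fps_nth (\<Sum>i\<in>UNIV. \<Gamma> i * fps_const (fst b' $ i)) (idx i) = fst b' $ i / fact (idx i)" for i
  proof -
    have "idx i = idx k \<longleftrightarrow> i = k" for k
      by (metis idx(1))
    then have "fps_nth (\<Sum>i\<in>UNIV. \<Gamma> i * fps_const (fst b' $ i)) (idx i) = (\<Sum>k\<in>UNIV. if i = k then fst b' $ i / fact (idx i) else 0)"
      unfolding fps_sum_nth using idx(3)[of i] by (intro sum.cong) (auto simp: \<Gamma>_nth)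
    then show ?thesis
      by simp
  qed
  moreover have "fps_nth (fps_const (snd b')) (idx i) = 0" for i
    using idx0[of i] by simp
  ultimately have "fst b' $ i = 0" for i
    by simp
  moreover have "fst b' $ i = c $ i" for i
    by (simp add: b'_def fst_sum b axis_def if_distrib cong: if_cong)
  ultimately have "c = 0"
    by (simp add: vec_eq_iff)
  with \<open>c \<noteq> 0\<close> show False
    by simp
qed

theorem theorem1p6:
  assumes "CARD('n::finite) \<ge> 5"
  shows "\<not> (\<exists>(H :: ((real^'n) \<times> real) set) p0.
            local_analytic_hypersurface H p0 \<and>
            affinely_homogeneous H p0 \<and>
            constant_hessian_rank_one H p0 \<and>
            nondegenerate H p0)"
proof
  assume "\<exists>(H :: ((real^'n) \<times> real) set) p0. local_analytic_hypersurface H p0 \<and>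
    affinely_homogeneous H p0 \<and> constant_hessian_rank_one H p0 \<and> nondegenerate H p0"
  then obtain H :: "((real^'n) \<times> real) set" and p0 where
    hom: "affinely_homogeneous H p0" and rank: "constant_hessian_rank_one H p0" and "nondegenerate H p0"
    by blast
  then obtain e \<phi> F R S where e: "bij_betw e {1..CARD('n)} (UNIV :: 'n set)"
    and \<phi>: "\<phi> p0 = 0" "is_graph_at \<phi> F H p0"
    and R: "R \<in> big_O_vars (e ` {2..CARD('n)}) 3" and S: "S \<in> big_O_vars UNIV (CARD('n) + 2)"
    and nf: "\<forall>\<^sub>F x in nhds 0. F x = normal_form_part e x + R x + S x"
    unfolding nondegenerate_def by blast
  have "real_analytic_at F 0"
    using \<phi> unfolding is_graph_at_def by simp
  moreover have "\<forall>\<^sub>F x in nhds 0. \<exists>p q. \<forall>i j. hessian F x $ i $ j = p i * q j"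
    using constant_hessian_rank_one_imp_outer_product[OF \<phi>(2) rank] \<phi>(1) by simp
  moreover have "\<exists>L. affine_vector_field L \<and> tangent_to_graph F 0 L \<and> fst (L 0) = axis i 1" for i
    using affinely_homogeneous_imp_transitive[OF \<phi>(2) hom, of i] \<phi>(1) by simp
  ultimately show False
    by (rule no_transitive_affine_symmetry[OF assms e R S nf])
qed

end
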